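(* The Silver forcing notion forces $\mathfrak{c}=|(\mathfrak{b}^{+\epsilon})^{V}|$.
   Context: The Silver forcing consists of partial functions $p$ with $\mathrm{dom}(p)\subseteq\omega$, $\omega\setminus\mathrm{dom}(p)$ infinite and $\mathrm{rng}(p)\subseteq 2$, ordered by inclusion (a larger function is a stronger condition). For $X\in[\omega]^\omega$ (infinite subsets of $\omega$), $\mu_X$ is the increasing enumeration of $X$. A family $\mathcal{F}\subseteq[\omega]^\omega$ is weakly dominating if for every $Y\in[\omega]^\omega$ there is $X\in\mathcal{F}$ such that for infinitely many $i$, for all $j<2^i$, $|[\mu_X(2^i+j),\mu_X(2^i+j+1))\cap Y|\geq 2$; $\mathfrak{b}^{+\epsilon}$ is the minimal size of a weakly dominating family, and $(\mathfrak{b}^{+\epsilon})^V$ is its value in the ground model. $\mathfrak{c}$ is the cardinality of the continuum. *)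

theory Defs
  imports Main "HOL-Library.Infinite_Set"
begin

unbundle cardinal_syntax

text \<open>\<^term>\<open>enumerate X\<close> is the increasing enumeration of an infinite set \<^term>\<open>X\<close>.\<close>

definition weakly_dominating :: "nat set set \<Rightarrow> bool" where
  "weakly_dominating F \<longleftrightarrow>
     (\<forall>X\<in>F. infinite X) \<and>
     (\<forall>Y. infinite Y \<longrightarrow>
        (\<exists>X\<in>F. \<exists>\<^sub>\<infinity>i. \<forall>j<2 ^ i.
            card ({enumerate X (2 ^ i + j)..<enumerate X (2 ^ i + j + 1)} \<inter> Y) \<ge> 2))"

text \<open>The minimal size of a weakly dominating family, as a cardinal order; it is determined up to
  order isomorphism.\<close>

definition b_plus_eps :: "nat set rel" where
  "b_plus_eps = |SOME F. weakly_dominating F \<and> (\<forall>G. weakly_dominating G \<longrightarrow> |F| \<le>o |G| )|"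

lemma strict_mono_same_range:
  fixes f g :: "nat \<Rightarrow> nat"
  assumes f: "strict_mono f" and g: "strict_mono g" and "range f = range g"
  shows "f n = g n"
proof (induction n rule: less_induct)
  case (less n)
  obtain k where k: "g n = f k" using assms(3) by (metis rangeE rangeI)
  obtain l where l: "f n = g l" using assms(3) by (metis rangeE rangeI)
  have "k \<ge> n" using less[of k] k g by (metis linorder_not_le strict_mono_eq less_irrefl)
  moreover have "l \<ge> n" using less[of l] l f by (metis linorder_not_le strict_mono_eq less_irrefl)
  ultimately show ?case
    using k l f g by (metis order_antisym strict_mono_less_eq)
qed

lemma weakly_dominating_infinite_sets: "weakly_dominating {X. infinite X}"
  unfolding weakly_dominating_def
proof (intro conjI ballI allI impI)
  fix Y :: "nat set" assume Y: "infinite Y"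
  define X where "X = range (\<lambda>n. enumerate Y (2 * n))"
  have sm: "strict_mono (\<lambda>n. enumerate Y (2 * n))"
    using Y by (auto simp: strict_mono_def enumerate_mono)
  have X: "infinite X"
    unfolding X_def using sm by (simp add: range_inj_infinite strict_mono_imp_inj_on)
  have eX: "enumerate X n = enumerate Y (2 * n)" for n
    using range_enumerate[OF X] strict_mono_enumerate[OF X] sm
    by (intro strict_mono_same_range) (auto simp: X_def)
  have "card ({enumerate X m..<enumerate X (m + 1)} \<inter> Y) \<ge> 2" for m
  proof -
    have "{enumerate Y (2 * m), enumerate Y (2 * m + 1)}
            \<subseteq> {enumerate X m..<enumerate X (m + 1)} \<inter> Y"
      using Y by (auto simp: eX enumerate_in_set enumerate_mono less_imp_le simp del: enumerate_Suc)
    moreover have "card {enumerate Y (2 * m), enumerate Y (2 * m + 1)} = 2"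
      using enumerate_mono[OF lessI Y, of "2 * m"] by (auto simp del: enumerate_Suc)
    ultimately show ?thesis
      by (metis card_mono finite_Int finite_atLeastLessThan)
  qed
  then show "\<exists>X\<in>{X. infinite X}. \<exists>\<^sub>\<infinity>i. \<forall>j<2 ^ i.
      card ({enumerate X (2 ^ i + j)..<enumerate X (2 ^ i + j + 1)} \<inter> Y) \<ge> 2"
    using X by (intro bexI[of _ X]) (auto simp: INFM_nat)
qed auto

lemma b_plus_eps_minimal:
  obtains F where "weakly_dominating F" "b_plus_eps = |F|"
    "\<And>G. weakly_dominating G \<Longrightarrow> |F| \<le>o |G|"
proof -
  have "\<exists>F. weakly_dominating F \<and> (\<forall>G. weakly_dominating G \<longrightarrow> |F| \<le>o |G| )"
  proof -
    let ?R = "card_of ` {F. weakly_dominating F}"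
    have "\<exists>r\<in>?R. \<forall>r'\<in>?R. r \<le>o r'"
      using weakly_dominating_infinite_sets
      by (intro exists_minim_Well_order) (auto intro: card_of_Well_order)
    then show ?thesis by auto
  qed
  from someI_ex[OF this] show ?thesis
    using that unfolding b_plus_eps_def by blast
qed

text \<open>Larger conditions are stronger. A name is a set of pairs of a name and a condition. As
  HOL has no type of all such hereditary sets, the elements of a name are indexed by the type
  \<^typ>\<open>'i\<close>, so that the type below consists, up to repetition of elements, of the names
  of hereditary cardinality at most that of \<^typ>\<open>'i\<close>.\<close>

datatype ('i, 'p) name = Name "'i \<Rightarrow> (('i, 'p) name \<times> 'p) option"

primrec elems :: "('i, 'p) name \<Rightarrow> (('i, 'p) name \<times> 'p) set" where
  "elems (Name f) = {z. Some z \<in> range f}"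

definition subname :: "('i, 'p) name rel" where
  "subname = {(c, a). \<exists>s. (c, s) \<in> elems a}"

lemma wf_subname: "wf subname"
proof (rule wfUNIVI)
  fix P :: "('i, 'p) name \<Rightarrow> bool" and a
  assume IH: "\<forall>a. (\<forall>c. (c, a) \<in> subname \<longrightarrow> P c) \<longrightarrow> P a"
  show "P a"
  proof (induction a)
    case (Name f)
    show ?case
    proof (rule IH[rule_format])
      fix c assume "(c, Name f) \<in> subname"
      then obtain s i where "f i = Some (c, s)"
        by (auto simp: subname_def image_iff) metis
      then show "P c"
        using Name.IH[of "f i" "(c, s)" c] by (metis fsts.intros option.set_intros rangeI fst_conv)
    qed
  qed
qed

function forces_eq :: "('i, 'p::preorder) name \<Rightarrow> ('i, 'p) name \<Rightarrow> 'p \<Rightarrow> bool" where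
  "forces_eq a b p \<longleftrightarrow>
     (\<forall>z\<in>elems a. \<forall>q\<ge>p. snd z \<le> q \<longrightarrow>
        (\<exists>w\<in>elems b. \<exists>r\<ge>q. snd w \<le> r \<and> forces_eq (fst z) (fst w) r)) \<and>
     (\<forall>w\<in>elems b. \<forall>q\<ge>p. snd w \<le> q \<longrightarrow>
        (\<exists>z\<in>elems a. \<exists>r\<ge>q. snd z \<le> r \<and> forces_eq (fst z) (fst w) r))"
  by pat_completeness auto
termination
proof (relation "inv_image subname fst")
  show "wf (inv_image (subname :: ('a, 'b) name rel) fst)"
    by (rule wf_inv_image[OF wf_subname])
qed (auto simp: subname_def)

declare forces_eq.simps [simp del]

text \<open>A sentence of the forcing language is represented by the set of conditions that force it;
  the clauses below are those of the usual recursive definition of the forcing relation.\<close>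

type_synonym 'p sentence = "'p \<Rightarrow> bool"

definition Eq :: "('i, 'p::preorder) name \<Rightarrow> ('i, 'p) name \<Rightarrow> 'p sentence"
    (infix "\<^bold>=" 50) where
  "(a \<^bold>= b) = forces_eq a b"

definition Mem :: "('i, 'p::preorder) name \<Rightarrow> ('i, 'p) name \<Rightarrow> 'p sentence"
    (infix "\<^bold>\<in>" 50) where
  "(a \<^bold>\<in> b) = (\<lambda>p. \<forall>q\<ge>p. \<exists>r\<ge>q. \<exists>w\<in>elems b. snd w \<le> r \<and> forces_eq a (fst w) r)"

definition Neg :: "'p::preorder sentence \<Rightarrow> 'p sentence" ("\<^bold>\<not> _" [40] 40) where
  "(\<^bold>\<not> \<phi>) = (\<lambda>p. \<forall>q\<ge>p. \<not> \<phi> q)"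

definition Conj :: "'p::preorder sentence \<Rightarrow> 'p sentence \<Rightarrow> 'p sentence"
    (infixr "\<^bold>\<and>" 35) where
  "(\<phi> \<^bold>\<and> \<psi>) = (\<lambda>p. \<phi> p \<and> \<psi> p)"

definition All_names :: "(('i, 'p) name \<Rightarrow> 'p::preorder sentence) \<Rightarrow> 'p sentence"
    (binder "\<^bold>\<forall>" 10) where
  "(\<^bold>\<forall>x. \<phi> x) = (\<lambda>p. \<forall>x. \<phi> x p)"

definition Disj :: "'p::preorder sentence \<Rightarrow> 'p sentence \<Rightarrow> 'p sentence"
    (infixr "\<^bold>\<or>" 30) where
  "(\<phi> \<^bold>\<or> \<psi>) = (\<^bold>\<not> (\<^bold>\<not> \<phi> \<^bold>\<and> \<^bold>\<not> \<psi>))"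

definition Imp :: "'p::preorder sentence \<Rightarrow> 'p sentence \<Rightarrow> 'p sentence"
    (infixr "\<^bold>\<longrightarrow>" 25) where
  "(\<phi> \<^bold>\<longrightarrow> \<psi>) = (\<^bold>\<not> (\<phi> \<^bold>\<and> \<^bold>\<not> \<psi>))"

definition Iff :: "'p::preorder sentence \<Rightarrow> 'p sentence \<Rightarrow> 'p sentence"
    (infix "\<^bold>\<longleftrightarrow>" 25) where
  "(\<phi> \<^bold>\<longleftrightarrow> \<psi>) = ((\<phi> \<^bold>\<longrightarrow> \<psi>) \<^bold>\<and> (\<psi> \<^bold>\<longrightarrow> \<phi>))"

definition Ex_name :: "(('i, 'p) name \<Rightarrow> 'p::preorder sentence) \<Rightarrow> 'p sentence"
    (binder "\<^bold>\<exists>" 10) where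
  "(\<^bold>\<exists>x. \<phi> x) = (\<^bold>\<not> (\<^bold>\<forall>x. \<^bold>\<not> \<phi> x))"

definition forced :: "'p::preorder sentence \<Rightarrow> bool" ("\<^bold>\<turnstile> _" [5] 5) where
  "(\<^bold>\<turnstile> \<phi>) \<longleftrightarrow> (\<forall>p. \<phi> p)"

definition mk_name :: "(('i, 'p) name \<times> 'p) set \<Rightarrow> ('i, 'p) name" where
  "mk_name S = (SOME a. elems a = S)"

lemma elems_mk_name:
  fixes S :: "(('i, 'p) name \<times> 'p) set"
  assumes "|S| \<le>o |UNIV :: 'i set|"
  shows "elems (mk_name S) = S"
proof -
  obtain g :: "_ \<Rightarrow> 'i" where g: "inj_on g S"
    using assms by (auto simp flip: card_of_ordLeq)
  define f where "f i = (if i \<in> g ` S then Some (inv_into S g i) else None)" for i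
  have "elems (Name f) = S"
  proof (intro set_eqI iffI)
    fix z assume "z \<in> elems (Name f)"
    then obtain i where "Some z = f i" by auto
    then show "z \<in> S" by (auto simp: f_def g split: if_splits)
  next
    fix z assume "z \<in> S"
    then have "Some z = f (g z)" by (simp add: f_def g)
    then show "z \<in> elems (Name f)" by auto
  qed
  then show ?thesis
    unfolding mk_name_def by (rule someI)
qed

text \<open>For a well-order \<^term>\<open>r\<close>, the check-name of the von Neumann ordinal that is the order type
  of the proper initial segment of \<^term>\<open>r\<close> below \<^term>\<open>x\<close>, and the check-name of the order type
  of \<^term>\<open>r\<close> itself. The weakest condition is \<^term>\<open>bot\<close>. These names are meaningful only
  if \<^typ>\<open>'i\<close> is at least as large as \<^term>\<open>Field r\<close>.\<close>

definition segment_name :: "'a rel \<Rightarrow> 'a \<Rightarrow> ('i, 'p::order_bot) name" where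
  "segment_name r =
     wfrec (r - Id) (\<lambda>f x. mk_name ((\<lambda>y. (f y, bot)) ` underS r x))"

definition ordinal_name :: "'a rel \<Rightarrow> ('i, 'p::order_bot) name" where
  "ordinal_name r = mk_name ((\<lambda>x. (segment_name r x, bot)) ` Field r)"

lemma segment_name_eq:
  assumes "Well_order r"
  shows "segment_name r x = mk_name ((\<lambda>y. (segment_name r y, bot)) ` underS r x)"
proof -
  have "wf (r - Id)"
    using assms by (simp add: well_order_on_def)
  then show ?thesis
    unfolding segment_name_def
    by (subst wfrec) (auto simp: cut_def underS_def intro!: arg_cong[where f = mk_name] image_cong)
qed

lemma elems_segment_name:
  fixes r :: "'a rel"
  assumes "Well_order r" "|Field r| \<le>o |UNIV :: 'i set|"
  shows "elems (segment_name r x :: ('i, 'p::order_bot) name)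
           = (\<lambda>y. (segment_name r y, bot)) ` underS r x"
proof -
  have "|underS r x| \<le>o |Field r|"
    by (intro card_of_mono1) (auto simp: underS_def Field_def)
  then show ?thesis
    unfolding segment_name_eq[OF assms(1), of x]
    by (intro elems_mk_name) (meson assms(2) card_of_image ordLeq_transitive)
qed

lemma elems_ordinal_name:
  fixes r :: "'a rel"
  assumes "|Field r| \<le>o |UNIV :: 'i set|"
  shows "elems (ordinal_name r :: ('i, 'p::order_bot) name)
           = (\<lambda>x. (segment_name r x, bot)) ` Field r"
  unfolding ordinal_name_def
  by (intro elems_mk_name) (meson assms card_of_image ordLeq_transitive)

definition is_subset :: "('i, 'p::preorder) name \<Rightarrow> ('i, 'p) name \<Rightarrow> 'p sentence" where
  "is_subset a b = (\<^bold>\<forall>x. x \<^bold>\<in> a \<^bold>\<longrightarrow> x \<^bold>\<in> b)"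

definition is_powerset :: "('i, 'p::preorder) name \<Rightarrow> ('i, 'p) name \<Rightarrow> 'p sentence" where
  "is_powerset c a = (\<^bold>\<forall>x. x \<^bold>\<in> c \<^bold>\<longleftrightarrow> is_subset x a)"

definition is_upair ::
    "('i, 'p::preorder) name \<Rightarrow> ('i, 'p) name \<Rightarrow> ('i, 'p) name \<Rightarrow> 'p sentence" where
  "is_upair z x y = (\<^bold>\<forall>w. w \<^bold>\<in> z \<^bold>\<longleftrightarrow> (w \<^bold>= x \<^bold>\<or> w \<^bold>= y))"

definition is_pair ::
    "('i, 'p::preorder) name \<Rightarrow> ('i, 'p) name \<Rightarrow> ('i, 'p) name \<Rightarrow> 'p sentence" where
  "is_pair u x y = (\<^bold>\<forall>z. z \<^bold>\<in> u \<^bold>\<longleftrightarrow> (is_upair z x x \<^bold>\<or> is_upair z x y))"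

definition pair_in ::
    "('i, 'p::preorder) name \<Rightarrow> ('i, 'p) name \<Rightarrow> ('i, 'p) name \<Rightarrow> 'p sentence" where
  "pair_in x y f = (\<^bold>\<exists>u. is_pair u x y \<^bold>\<and> u \<^bold>\<in> f)"

definition is_bijection ::
    "('i, 'p::preorder) name \<Rightarrow> ('i, 'p) name \<Rightarrow> ('i, 'p) name \<Rightarrow> 'p sentence" where
  "is_bijection f a b =
     ((\<^bold>\<forall>u. u \<^bold>\<in> f \<^bold>\<longrightarrow>
         (\<^bold>\<exists>x y. x \<^bold>\<in> a \<^bold>\<and> y \<^bold>\<in> b \<^bold>\<and> is_pair u x y)) \<^bold>\<and>
      (\<^bold>\<forall>x. x \<^bold>\<in> a \<^bold>\<longrightarrow> (\<^bold>\<exists>y. pair_in x y f)) \<^bold>\<and>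
      (\<^bold>\<forall>x y y'. pair_in x y f \<^bold>\<and> pair_in x y' f \<^bold>\<longrightarrow> y \<^bold>= y') \<^bold>\<and>
      (\<^bold>\<forall>y. y \<^bold>\<in> b \<^bold>\<longrightarrow> (\<^bold>\<exists>x. pair_in x y f)) \<^bold>\<and>
      (\<^bold>\<forall>x x' y. pair_in x y f \<^bold>\<and> pair_in x' y f \<^bold>\<longrightarrow> x \<^bold>= x'))"

definition same_cardinality :: "('i, 'p::preorder) name \<Rightarrow> ('i, 'p) name \<Rightarrow> 'p sentence" where
  "same_cardinality a b = (\<^bold>\<exists>f. is_bijection f a b)"

text \<open>The power set of \<open>\<omega>\<close> is taken in the extension, and equality of cardinals is the
  existence in the extension of a bijection. If \<^typ>\<open>'i\<close> is at least as large as the continuum of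
  the ground model, there are enough names for all subsets of \<open>\<omega>\<close>, for \<open>\<omega>\<close> itself and
  for ground model sets of at most continuum size.\<close>

definition continuum_is_card_of :: "('i, 'p::order_bot) name \<Rightarrow> 'p sentence" where
  "continuum_is_card_of a =
     (\<^bold>\<exists>c. is_powerset c (ordinal_name natLeq) \<^bold>\<and> same_cardinality c a)"

typedef silver = "{p :: nat \<rightharpoonup> bool. infinite (- dom p)}"
  morphisms fun_of Silver
  by (intro exI[of _ Map.empty]) simp

instantiation silver :: order_bot
begin

definition less_eq_silver :: "silver \<Rightarrow> silver \<Rightarrow> bool" where
  "p \<le> q \<longleftrightarrow> fun_of p \<subseteq>\<^sub>m fun_of q"

definition less_silver :: "silver \<Rightarrow> silver \<Rightarrow> bool" where
  "(p::silver) < q \<longleftrightarrow> p \<le> q \<and> \<not> q \<le> p"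

definition bot_silver :: silver where
  "bot = Silver Map.empty"

instance
proof
  fix p q r :: silver
  show "p < q \<longleftrightarrow> p \<le> q \<and> \<not> q \<le> p" by (rule less_silver_def)
  show "p \<le> p" by (simp add: less_eq_silver_def)
  show "p \<le> q \<Longrightarrow> q \<le> r \<Longrightarrow> p \<le> r" by (auto simp: less_eq_silver_def intro: map_le_trans)
  show "p \<le> q \<Longrightarrow> q \<le> p \<Longrightarrow> p = q"
    by (auto simp: less_eq_silver_def fun_of_inject dest: map_le_antisym)
  show "bot \<le> p" by (simp add: less_eq_silver_def bot_silver_def Silver_inverse)
qed

end

end

theory Submission
  imports Defs "HOL-Library.Countable"
begin

text \<open>
  A Silver condition leaves an infinite set of points undetermined. If a set \<open>X\<close> of a weakly
  dominating family is chosen for this set, then the condition can be shrunk along any branch of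
  the binary tree so that on the levels of \<open>X\<close> only points in the intervals on the branch
  remain free. Conditions thinned along different branches are incompatible, because almost no
  point stays free in a common extension. As there are as many branches as pairs of a condition
  and a ground model real, the branch can code a prescribed real, and so the generic real and the
  family members enumerate the ground model reals. By fusion every real of the extension is coded
  by a ground model real, hence the family also indexes all reals of the extension. Conversely
  its members are distinct reals, and a Cantor--Bernstein argument inside the forcing language
  gives the bijection.
\<close>

subsection \<open>The forcing relation\<close>

text \<open>Which real a family member codes is settled only by the generic filter, and different
  members may code the same real. Hence the enumeration runs over omega times the family,
  equinumerous with the family because a weakly dominating family is infinite: the entries with
  first index 0 are the coded reals and exhaust the power set, while those with positive first index
  are fixed, pairwise distinct ground model reals. The latter supply the injection and leave the
  room needed to absorb repetitions among the former. Whether an entry is a repetition is again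
  settled only by extending the condition, so the name of the bijection lists every condition that
  settles the question. The shape of weak domination matches the binary tree: its requirement at
  \<open>i\<close> concerns \<open>2 ^ i\<close> consecutive intervals, one for each node of level
  \<open>i\<close>. Every branch therefore keeps free points at infinitely many levels, whichever
  real is to be coded.\<close>

lemma forces_eqI:
  assumes "\<And>z q. z \<in> elems a \<Longrightarrow> p \<le> q \<Longrightarrow> snd z \<le> q \<Longrightarrow>
      \<exists>w\<in>elems b. \<exists>r\<ge>q. snd w \<le> r \<and> forces_eq (fst z) (fst w) r"
    and "\<And>w q. w \<in> elems b \<Longrightarrow> p \<le> q \<Longrightarrow> snd w \<le> q \<Longrightarrow>
      \<exists>z\<in>elems a. \<exists>r\<ge>q. snd z \<le> r \<and> forces_eq (fst z) (fst w) r"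
  shows "forces_eq a b p"
  using assms by (subst forces_eq.simps) blast

lemma forces_eqD1:
  assumes "forces_eq a b p" "z \<in> elems a" "p \<le> q" "snd z \<le> q"
  obtains w r where "w \<in> elems b" "q \<le> r" "snd w \<le> r" "forces_eq (fst z) (fst w) r"
  using assms by (subst (asm) forces_eq.simps) blast

lemma forces_eqD2:
  assumes "forces_eq a b p" "w \<in> elems b" "p \<le> q" "snd w \<le> q"
  obtains z r where "z \<in> elems a" "q \<le> r" "snd z \<le> r" "forces_eq (fst z) (fst w) r"
  using assms by (subst (asm) forces_eq.simps) blast

lemma forces_eq_mono: "forces_eq a b p \<Longrightarrow> p \<le> q \<Longrightarrow> forces_eq a b q"
  by (rule forces_eqI) (meson forces_eqD1 forces_eqD2 order_trans)+

text \<open>Together with \<open>Mem_dense\<close> this licenses the pattern used throughout: to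
  force an atomic sentence, extend the condition until all witnesses are at hand and argue
  there.\<close>

lemma forces_eq_dense:
  assumes "\<And>q. p \<le> q \<Longrightarrow> \<exists>r\<ge>q. forces_eq a b r"
  shows "forces_eq a b p"
proof (rule forces_eqI)
  fix z q assume z: "z \<in> elems a" "p \<le> q" "snd z \<le> q"
  then obtain r where "r \<ge> q" "forces_eq a b r" using assms by blast
  then show "\<exists>w\<in>elems b. \<exists>r\<ge>q. snd w \<le> r \<and> forces_eq (fst z) (fst w) r"
    using z by (elim forces_eqD1[OF _ z(1) order_refl]) (blast intro: order_trans)+
next
  fix z q assume z: "z \<in> elems b" "p \<le> q" "snd z \<le> q"
  then obtain r where "r \<ge> q" "forces_eq a b r" using assms by blast
  then show "\<exists>w\<in>elems a. \<exists>r\<ge>q. snd w \<le> r \<and> forces_eq (fst w) (fst z) r"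
    using z by (elim forces_eqD2[OF _ z(1) order_refl]) (blast intro: order_trans)+
qed

lemma name_induct [case_names name]:
  assumes "\<And>a. (\<And>z. z \<in> elems a \<Longrightarrow> P (fst z)) \<Longrightarrow> P a"
  shows "P (a :: ('i, 'p) name)"
  using wf_subname
proof (induction a rule: wf_induct_rule)
  case (less a)
  show ?case
  proof (rule assms)
    fix z assume "z \<in> elems a"
    then have "(fst z, a) \<in> subname"
      by (auto simp: subname_def intro: exI[of _ "snd z"])
    then show "P (fst z)" by (rule less)
  qed
qed

lemma forces_eq_refl: "forces_eq a a p"
proof (induction a arbitrary: p rule: name_induct)
  case (name a)
  then show ?case
    by (intro forces_eqI) (blast intro: order_refl)+
qed

lemma forces_eq_sym: "forces_eq a b p \<Longrightarrow> forces_eq b a p"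
proof (induction a arbitrary: b p rule: name_induct)
  case (name a)
  show ?case
  proof (rule forces_eqI)
    fix z q assume "z \<in> elems b" "p \<le> q" "snd z \<le> q"
    then show "\<exists>w\<in>elems a. \<exists>r\<ge>q. snd w \<le> r \<and> forces_eq (fst z) (fst w) r"
      using name by (meson forces_eqD2)
  next
    fix w q assume "w \<in> elems a" "p \<le> q" "snd w \<le> q"
    then show "\<exists>z\<in>elems b. \<exists>r\<ge>q. snd z \<le> r \<and> forces_eq (fst z) (fst w) r"
      using name by (meson forces_eqD1)
  qed
qed

lemma forces_eq_trans: "forces_eq a b p \<Longrightarrow> forces_eq b c p \<Longrightarrow> forces_eq a c p"
proof (induction a arbitrary: b c p rule: name_induct)
  case (name a)
  show ?case
  proof (rule forces_eqI)
    fix z q assume z: "z \<in> elems a" "p \<le> q" "snd z \<le> q"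
    obtain w r where w: "w \<in> elems b" "q \<le> r" "snd w \<le> r" "forces_eq (fst z) (fst w) r"
      using forces_eqD1[OF name.prems(1) z] .
    obtain v s where v: "v \<in> elems c" "r \<le> s" "snd v \<le> s" "forces_eq (fst w) (fst v) s"
      using forces_eqD1[OF name.prems(2) w(1) _ w(3)] z(2) w(2) by (metis order_trans)
    then show "\<exists>v\<in>elems c. \<exists>s\<ge>q. snd v \<le> s \<and> forces_eq (fst z) (fst v) s"
      using name.IH[OF z(1)] w by (meson forces_eq_mono order_trans)
  next
    fix v q assume v: "v \<in> elems c" "p \<le> q" "snd v \<le> q"
    obtain w r where w: "w \<in> elems b" "q \<le> r" "snd w \<le> r" "forces_eq (fst w) (fst v) r"
      using forces_eqD2[OF name.prems(2) v] .
    obtain z s where z: "z \<in> elems a" "r \<le> s" "snd z \<le> s" "forces_eq (fst z) (fst w) s"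
      using forces_eqD2[OF name.prems(1) w(1) _ w(3)] v(2) w(2) by (metis order_trans)
    then show "\<exists>z\<in>elems a. \<exists>s\<ge>q. snd z \<le> s \<and> forces_eq (fst z) (fst v) s"
      using name.IH[OF z(1)] w by (meson forces_eq_mono order_trans)
  qed
qed

lemma Mem_mono: "(a \<^bold>\<in> b) p \<Longrightarrow> p \<le> q \<Longrightarrow> (a \<^bold>\<in> b) q"
  unfolding Mem_def by (meson order_trans)

lemma Mem_dense: "(\<And>q. p \<le> q \<Longrightarrow> \<exists>r\<ge>q. (a \<^bold>\<in> b) r) \<Longrightarrow> (a \<^bold>\<in> b) p"
  unfolding Mem_def by (metis order_trans order_refl)

lemma Mem_elem: "w \<in> elems b \<Longrightarrow> snd w \<le> p \<Longrightarrow> (fst w \<^bold>\<in> b) p"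
  unfolding Mem_def by (blast intro: forces_eq_refl order_trans)

lemma MemE:
  assumes "(a \<^bold>\<in> b) p"
  obtains w r where "w \<in> elems b" "p \<le> r" "snd w \<le> r" "forces_eq a (fst w) r"
  using assms unfolding Mem_def by blast

lemma Mem_cong_left: "forces_eq a a' p \<Longrightarrow> (a \<^bold>\<in> b) p \<Longrightarrow> (a' \<^bold>\<in> b) p"
  unfolding Mem_def by (meson forces_eq_sym forces_eq_trans forces_eq_mono order_trans)

lemma Mem_cong_right:
  assumes "forces_eq b b' p" "(a \<^bold>\<in> b) p"
  shows "(a \<^bold>\<in> b') p"
proof (rule Mem_dense)
  fix q assume "p \<le> q"
  obtain w r where w: "w \<in> elems b" "q \<le> r" "snd w \<le> r" "forces_eq a (fst w) r"
    using MemE[OF Mem_mono[OF assms(2) \<open>p \<le> q\<close>]] .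
  obtain v s where v: "v \<in> elems b'" "r \<le> s" "snd v \<le> s" "forces_eq (fst w) (fst v) s"
    using forces_eqD1[OF assms(1) w(1) _ w(3)] \<open>p \<le> q\<close> w(2) by (metis order_trans)
  have "(fst v \<^bold>\<in> b') s" using v Mem_elem by blast
  moreover have "forces_eq (fst v) a s"
    using v w by (meson forces_eq_sym forces_eq_trans forces_eq_mono)
  ultimately show "\<exists>s\<ge>q. (a \<^bold>\<in> b') s"
    using v w Mem_cong_left by (meson order_trans)
qed

lemma forces_eq_if_Mem:
  assumes "\<And>z q. z \<in> elems a \<Longrightarrow> p \<le> q \<Longrightarrow> snd z \<le> q \<Longrightarrow> (fst z \<^bold>\<in> b) q"
    and "\<And>z q. z \<in> elems b \<Longrightarrow> p \<le> q \<Longrightarrow> snd z \<le> q \<Longrightarrow> (fst z \<^bold>\<in> a) q"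
  shows "forces_eq a b p"
  by (rule forces_eqI) (meson assms MemE forces_eq_sym)+

section \<open>Density characterisations of the connectives\<close>

lemma Imp_iff: "(\<phi> \<^bold>\<longrightarrow> \<psi>) p \<longleftrightarrow> (\<forall>q\<ge>p. \<phi> q \<longrightarrow> (\<exists>r\<ge>q. \<psi> r))"
  by (auto simp: Imp_def Neg_def Conj_def)

lemma Disj_iff: "(\<phi> \<^bold>\<or> \<psi>) p \<longleftrightarrow> (\<forall>q\<ge>p. \<exists>r\<ge>q. \<phi> r \<or> \<psi> r)"
  by (auto simp: Disj_def Neg_def Conj_def)

lemma Ex_name_iff: "(\<^bold>\<exists>x. \<phi> x) p \<longleftrightarrow> (\<forall>q\<ge>p. \<exists>r\<ge>q. \<exists>x. \<phi> x r)"
  unfolding Ex_name_def All_names_def Neg_def by blast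

lemma All_names_iff: "(\<^bold>\<forall>x. \<phi> x) p \<longleftrightarrow> (\<forall>x. \<phi> x p)"
  by (simp add: All_names_def)

lemma Conj_All_names_iff: "((\<^bold>\<forall>x. \<phi> x) \<^bold>\<and> \<psi>) p \<longleftrightarrow> (\<forall>x. \<phi> x p) \<and> \<psi> p"
  by (simp add: Conj_def All_names_def)

text \<open>An implication hides a double negation and so yields its conclusion only densely;
  membership absorbs this by \<open>Mem_dense\<close>, and the plain Kripke reading remains.\<close>

lemma Imp_Mem_iff:
  assumes "\<And>p q. \<phi> p \<Longrightarrow> p \<le> q \<Longrightarrow> \<phi> q"
  shows "(\<phi> \<^bold>\<longrightarrow> a \<^bold>\<in> b) p \<longleftrightarrow> (\<forall>q\<ge>p. \<phi> q \<longrightarrow> (a \<^bold>\<in> b) q)"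
proof -
  have "(a \<^bold>\<in> b) q" if "(\<phi> \<^bold>\<longrightarrow> a \<^bold>\<in> b) p" "p \<le> q" "\<phi> q" for q
    using that assms by (intro Mem_dense) (auto simp: Imp_iff intro: order_trans)
  then show ?thesis by (auto simp: Imp_iff)
qed

lemma is_subset_iff: "is_subset a b p \<longleftrightarrow> (\<forall>x. \<forall>q\<ge>p. (x \<^bold>\<in> a) q \<longrightarrow> (x \<^bold>\<in> b) q)"
  unfolding is_subset_def All_names_def
  by (simp add: Imp_Mem_iff Mem_mono)

lemma is_subset_mono: "is_subset a b p \<Longrightarrow> p \<le> q \<Longrightarrow> is_subset a b q"
  unfolding is_subset_iff by (meson order_trans)

lemma is_subset_cong_left: "forces_eq a a' p \<Longrightarrow> is_subset a b p \<Longrightarrow> is_subset a' b p"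
  unfolding is_subset_iff by (meson Mem_cong_right forces_eq_mono forces_eq_sym)

lemma is_subset_dense: "(\<And>q. p \<le> q \<Longrightarrow> \<exists>r\<ge>q. is_subset a b r) \<Longrightarrow> is_subset a b p"
  unfolding is_subset_iff
proof (intro allI impI)
  fix x q
  assume dense: "\<And>q. p \<le> q \<Longrightarrow> \<exists>r\<ge>q. \<forall>x. \<forall>q\<ge>r. (x \<^bold>\<in> a) q \<longrightarrow> (x \<^bold>\<in> b) q"
    and "p \<le> q" "(x \<^bold>\<in> a) q"
  show "(x \<^bold>\<in> b) q"
  proof (rule Mem_dense)
    fix q' assume "q \<le> q'"
    then obtain r where "q' \<le> r" "\<forall>x. \<forall>q\<ge>r. (x \<^bold>\<in> a) q \<longrightarrow> (x \<^bold>\<in> b) q"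
      using dense[of q'] \<open>p \<le> q\<close> order_trans by blast
    moreover have "(x \<^bold>\<in> a) r"
      using Mem_mono[OF \<open>(x \<^bold>\<in> a) q\<close>] \<open>q \<le> q'\<close> \<open>q' \<le> r\<close> order_trans by blast
    ultimately show "\<exists>r\<ge>q'. (x \<^bold>\<in> b) r" by blast
  qed
qed

lemma is_subsetI:
  assumes "\<And>z q. z \<in> elems a \<Longrightarrow> p \<le> q \<Longrightarrow> snd z \<le> q \<Longrightarrow> (fst z \<^bold>\<in> b) q"
  shows "is_subset a b p"
  unfolding is_subset_iff
proof (intro allI impI)
  fix x q assume "p \<le> q" and x: "(x \<^bold>\<in> a) q"
  show "(x \<^bold>\<in> b) q"
  proof (rule Mem_dense)
    fix q' assume "q \<le> q'"
    then obtain w r where "w \<in> elems a" "q' \<le> r" "snd w \<le> r" "forces_eq x (fst w) r"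
      using x by (meson Mem_mono MemE)
    then show "\<exists>r\<ge>q'. (x \<^bold>\<in> b) r"
      using assms \<open>p \<le> q\<close> \<open>q \<le> q'\<close> by (meson Mem_cong_left forces_eq_sym order_trans)
  qed
qed

lemma forces_eq_if_is_subset: "is_subset a b p \<Longrightarrow> is_subset b a p \<Longrightarrow> forces_eq a b p"
  unfolding is_subset_iff by (intro forces_eq_if_Mem) (meson Mem_elem)+

text \<open>Stated as an equality of sentences, that is of sets of conditions, so that it rewrites
  inside the definitions of unordered and ordered pairs.\<close>

lemma extensionality: "(\<^bold>\<forall>w. w \<^bold>\<in> a \<^bold>\<longleftrightarrow> w \<^bold>\<in> b) = (a \<^bold>= b)"
proof
  fix p
  have "(\<^bold>\<forall>w. w \<^bold>\<in> a \<^bold>\<longleftrightarrow> w \<^bold>\<in> b) p \<longleftrightarrow> is_subset a b p \<and> is_subset b a p"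
    by (auto simp: is_subset_def All_names_def Iff_def Conj_def)
  also have "\<dots> \<longleftrightarrow> forces_eq a b p"
  proof
    assume "is_subset a b p \<and> is_subset b a p"
    then show "forces_eq a b p" using forces_eq_if_is_subset by blast
  next
    assume "forces_eq a b p"
    then show "is_subset a b p \<and> is_subset b a p"
      unfolding is_subset_iff by (meson Mem_cong_right forces_eq_mono forces_eq_sym)
  qed
  finally show "(\<^bold>\<forall>w. w \<^bold>\<in> a \<^bold>\<longleftrightarrow> w \<^bold>\<in> b) p = (a \<^bold>= b) p" by (simp add: Eq_def)
qed

section \<open>Kuratowski pairs in the forcing language\<close>

definition upair_name :: "('i, 'p) name \<Rightarrow> ('i, 'p) name \<Rightarrow> ('i, 'p::order_bot) name" where
  "upair_name x y = mk_name {(x, bot), (y, bot)}"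

definition pair_name :: "('i, 'p) name \<Rightarrow> ('i, 'p) name \<Rightarrow> ('i, 'p::order_bot) name" where
  "pair_name x y = upair_name (upair_name x x) (upair_name x y)"

context
  assumes infinite_index: "infinite (UNIV :: 'i set)"
begin

lemma elems_upair_name: "elems (upair_name x y :: ('i, 'p::order_bot) name) = {(x, bot), (y, bot)}"
  unfolding upair_name_def
proof (rule elems_mk_name)
  show "|{(x, bot :: 'p), (y, bot)}| \<le>o |UNIV :: 'i set|"
    using ordLeq_total[OF card_of_Well_order card_of_Well_order] infinite_index
    by (meson card_of_ordLeq_finite finite.intros)
qed

lemma Mem_upair_name: "(w \<^bold>\<in> upair_name x y) = (w \<^bold>= x \<^bold>\<or> w \<^bold>= (y :: ('i, 'p::order_bot) name))"
  by (rule ext) (simp add: Mem_def Disj_iff elems_upair_name Eq_def)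

lemma is_upair_eq: "is_upair z x y = (z \<^bold>= upair_name x (y :: ('i, 'p::order_bot) name))"
  unfolding is_upair_def Mem_upair_name[symmetric] extensionality ..

lemma is_pair_eq: "is_pair u x y = (u \<^bold>= pair_name x (y :: ('i, 'p::order_bot) name))"
  unfolding is_pair_def is_upair_eq Mem_upair_name[symmetric] extensionality pair_name_def ..

text \<open>Trades the existential quantifier over pairs for membership of one concrete name, to
  which the congruence and density rules for membership apply.\<close>

lemma pair_in_eq: "pair_in x y f = (pair_name x (y :: ('i, 'p::order_bot) name) \<^bold>\<in> f)"
proof
  fix p
  show "pair_in x y f p = (pair_name x y \<^bold>\<in> f) p"
  proof
    assume "pair_in x y f p"
    then show "(pair_name x y \<^bold>\<in> f) p"
      unfolding pair_in_def is_pair_eq Ex_name_iff Conj_def Eq_def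
      by (intro Mem_dense) (blast intro: Mem_cong_left)
  next
    assume "(pair_name x y \<^bold>\<in> f) p"
    then show "pair_in x y f p"
      unfolding pair_in_def is_pair_eq Ex_name_iff Conj_def Eq_def
      by (blast intro: forces_eq_refl Mem_mono)
  qed
qed

lemma Mem_upair_nameE:
  assumes "(w \<^bold>\<in> upair_name x (y :: ('i, 'p::order_bot) name)) p"
  obtains r where "p \<le> r" "forces_eq w x r \<or> forces_eq w y r"
  using assms unfolding Mem_upair_name Disj_iff Eq_def by blast

lemma Mem_upair_name1: "(x \<^bold>\<in> upair_name x (y :: ('i, 'p::order_bot) name)) p"
  unfolding Mem_upair_name Disj_iff Eq_def by (blast intro: forces_eq_refl)

lemma Mem_upair_name2: "(y \<^bold>\<in> upair_name x (y :: ('i, 'p::order_bot) name)) p"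
  unfolding Mem_upair_name Disj_iff Eq_def by (blast intro: forces_eq_refl)

lemma upair_name_cong:
  assumes "forces_eq x x' p" "forces_eq y (y' :: ('i, 'p::order_bot) name) p"
  shows "forces_eq (upair_name x y) (upair_name x' y') p"
proof (rule forces_eq_if_Mem)
  fix z q assume z: "z \<in> elems (upair_name x y)" "p \<le> q"
  have "(x' \<^bold>\<in> upair_name x' y') q" "(y' \<^bold>\<in> upair_name x' y') q"
    by (rule Mem_upair_name1 Mem_upair_name2)+
  then have "(x \<^bold>\<in> upair_name x' y') q" "(y \<^bold>\<in> upair_name x' y') q"
    using Mem_cong_left forces_eq_sym forces_eq_mono[OF _ \<open>p \<le> q\<close>] assms by metis+
  then show "(fst z \<^bold>\<in> upair_name x' y') q"
    using z by (auto simp: elems_upair_name)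
next
  fix z q assume z: "z \<in> elems (upair_name x' y')" "p \<le> q"
  have "(x \<^bold>\<in> upair_name x y) q" "(y \<^bold>\<in> upair_name x y) q"
    by (rule Mem_upair_name1 Mem_upair_name2)+
  then have "(x' \<^bold>\<in> upair_name x y) q" "(y' \<^bold>\<in> upair_name x y) q"
    using Mem_cong_left forces_eq_mono[OF _ \<open>p \<le> q\<close>] assms by metis+
  then show "(fst z \<^bold>\<in> upair_name x y) q"
    using z by (auto simp: elems_upair_name)
qed

lemma pair_name_cong:
  assumes "forces_eq x x' p" "forces_eq y (y' :: ('i, 'p::order_bot) name) p"
  shows "forces_eq (pair_name x y) (pair_name x' y') p"
  unfolding pair_name_def by (intro upair_name_cong assms)

lemma upair_name_singleton_eq:
  fixes x x' y' :: "('i, 'p::order_bot) name"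
  assumes "forces_eq (upair_name x x) (upair_name x' y') p"
  shows "forces_eq x' x p"
proof (rule forces_eq_dense)
  fix q assume "p \<le> q"
  then have "(x' \<^bold>\<in> upair_name x x) q"
    using assms by (meson Mem_upair_name1 Mem_cong_right forces_eq_sym forces_eq_mono)
  then show "\<exists>r\<ge>q. forces_eq x' x r" by (elim Mem_upair_nameE) blast
qed

lemma pair_name_eq_fst:
  fixes x x' y y' :: "('i, 'p::order_bot) name"
  assumes "forces_eq (pair_name x y) (pair_name x' y') p"
  shows "forces_eq x x' p"
proof (rule forces_eq_dense)
  fix q assume "p \<le> q"
  then have "(upair_name x x \<^bold>\<in> pair_name x' y') q"
    using assms Mem_upair_name1 unfolding pair_name_def by (meson Mem_cong_right forces_eq_mono)
  then show "\<exists>r\<ge>q. forces_eq x x' r"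
    unfolding pair_name_def
    by (elim Mem_upair_nameE) (meson forces_eq_sym upair_name_singleton_eq)
qed

lemma pair_name_eq_snd_dense:
  fixes x x' y y' :: "('i, 'p::order_bot) name"
  assumes "forces_eq (pair_name x y) (pair_name x' y') p"
  shows "\<exists>r\<ge>p. forces_eq y x' r \<or> forces_eq y y' r"
proof -
  have "(upair_name x y \<^bold>\<in> pair_name x' y') p"
    using assms Mem_upair_name2 unfolding pair_name_def by (meson Mem_cong_right)
  then obtain z r where r: "p \<le> r" "forces_eq (upair_name x y) (upair_name x' z) r" "z = x' \<or> z = y'"
    unfolding pair_name_def by (elim Mem_upair_nameE) blast
  then have "(y \<^bold>\<in> upair_name x' z) r" by (meson Mem_upair_name2 Mem_cong_right)
  then show ?thesis using r by (elim Mem_upair_nameE) (meson order_trans)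
qed

text \<open>Comparing the two-element components in one direction leaves the degenerate case that
  \<open>y\<close> equals \<open>x'\<close>. The opposite comparison gives that \<open>y'\<close>
  equals \<open>x\<close> or \<open>y\<close>, and as \<open>x\<close> equals \<open>x'\<close> all
  cases agree. Each disjunction costs one extension of the condition.\<close>

lemma pair_name_eq_snd:
  fixes x x' y y' :: "('i, 'p::order_bot) name"
  assumes "forces_eq (pair_name x y) (pair_name x' y') p"
  shows "forces_eq y y' p"
proof (rule forces_eq_dense)
  fix q assume "p \<le> q"
  then have q: "forces_eq (pair_name x y) (pair_name x' y') q"
    using assms forces_eq_mono by blast
  then obtain r where r: "q \<le> r" "forces_eq y x' r \<or> forces_eq y y' r"
    using pair_name_eq_snd_dense by blast
  obtain s where s: "r \<le> s" "forces_eq y' x s \<or> forces_eq y' y s"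
    using pair_name_eq_snd_dense[OF forces_eq_sym[OF forces_eq_mono[OF q r(1)]]] by blast
  have "forces_eq x x' s"
    using forces_eq_mono[OF forces_eq_mono[OF q r(1)] s(1)] by (rule pair_name_eq_fst)
  moreover have "forces_eq y x' s \<or> forces_eq y y' s"
    using r(2) forces_eq_mono[OF _ s(1)] by blast
  ultimately have "forces_eq y y' s"
    using s(2) forces_eq_sym forces_eq_trans by blast
  then show "\<exists>s\<ge>q. forces_eq y y' s" using r s by (meson order_trans)
qed

end

text \<open>Descent: if the names agreed, the name for \<open>x\<close>, an element of the one for
  \<open>y\<close>, would be an element of itself. Some \<open>z\<close> below \<open>x\<close>
  would then have the same name as \<open>x\<close> under a stronger condition, against the
  induction hypothesis for \<open>z\<close> and \<open>x\<close>.\<close>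

lemma segment_name_not_eq:
  fixes r :: "'a rel" and p :: "'p::order_bot"
  assumes r: "Well_order r" "|Field r| \<le>o |UNIV :: 'i set|"
    and xy: "x \<in> underS r y"
  shows "\<not> forces_eq (segment_name r x :: ('i, 'p) name) (segment_name r y) p"
proof -
  have "wf (r - Id)" using r by (simp add: well_order_on_def)
  then show ?thesis using xy
  proof (induction x arbitrary: y p rule: wf_induct_rule)
    case (less x)
    show ?case
    proof
      assume eq: "forces_eq (segment_name r x :: ('i, 'p) name) (segment_name r y) p"
      have "(segment_name r x, bot) \<in> elems (segment_name r y :: ('i, 'p) name)"
        using less.prems by (simp add: elems_segment_name[OF r])
      from forces_eqD2[OF eq this order_refl]
      obtain w s where "w \<in> elems (segment_name r x :: ('i, 'p) name)"
        "forces_eq (fst w) (segment_name r x) s"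
        by simp metis
      then obtain z where z: "z \<in> underS r x"
        "forces_eq (segment_name r z :: ('i, 'p) name) (segment_name r x) s"
        by (auto simp: elems_segment_name[OF r])
      then show False using less.IH[of z x s] by (auto simp: underS_def)
    qed
  qed
qed

lemma segment_name_eq_imp_eq:
  fixes r :: "'a rel" and p :: "'p::order_bot"
  assumes r: "Well_order r" "|Field r| \<le>o |UNIV :: 'i set|"
    and xy: "x \<in> Field r" "y \<in> Field r"
    and eq: "forces_eq (segment_name r x :: ('i, 'p) name) (segment_name r y) p"
  shows "x = y"
proof (rule ccontr)
  assume "x \<noteq> y"
  then have "x \<in> underS r y \<or> y \<in> underS r x"
    using r(1) xy by (auto simp: order_on_defs total_on_def underS_def)
  then show False using segment_name_not_eq[OF r] eq forces_eq_sym by blast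
qed

subsection \<open>Bijections from exhaustive enumerations of the reals\<close>

text \<open>Separates the Cantor--Bernstein argument from the combinatorics of Silver forcing.
  \<open>d\<close> converts elements of the ordinal into indices of the enumeration. The bound
  \<open>size\<close> counts conditions as well because the name of the bijection attaches
  conditions to its pairs.\<close>

locale exhaustive_names =
  fixes r :: "'a rel" and d :: "'a \<Rightarrow> nat \<times> 'a"
    and \<rho> :: "nat \<times> 'a \<Rightarrow> ('i, 'p::order_bot) name"
  assumes infinite_index: "infinite (UNIV :: 'i set)"
    and well_order: "Well_order r"
    and size: "|Field r \<times> (UNIV :: 'p set)| \<le>o |UNIV :: 'i set|"
    and d: "bij_betw d (Field r) (UNIV \<times> Field r)"
    and subset_omega: "k \<in> Field r \<Longrightarrow> is_subset (\<rho> (n, k)) (ordinal_name natLeq) p"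
    and exhaustive: "is_subset x (ordinal_name natLeq) p \<Longrightarrow>
      \<exists>q\<ge>p. \<exists>k\<in>Field r. forces_eq x (\<rho> (0, k)) q"
    and Suc_distinct: "forces_eq (\<rho> (Suc m, k)) (\<rho> (Suc n, l)) p \<Longrightarrow>
      k \<in> Field r \<Longrightarrow> l \<in> Field r \<Longrightarrow> (m, k) = (n, l)"
begin

lemma Field_size: "|Field r| \<le>o |UNIV :: 'i set|"
  using size card_of_Times1[of "UNIV :: 'p set" "Field r"] ordLeq_transitive by blast

text \<open>Among all codes of a real that is not a positive entry, this singles out the
  \<open>r\<close>-least one. Both clauses are forced negations, hence the quantifier over
  extensions.\<close>

definition new :: "'a \<Rightarrow> 'p \<Rightarrow> bool" where
  "new k p \<longleftrightarrow> (\<forall>q\<ge>p. (\<forall>l\<in>underS r k. \<not> forces_eq (\<rho> (0, k)) (\<rho> (0, l)) q) \<and>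
     (\<forall>n. \<forall>l\<in>Field r. \<not> forces_eq (\<rho> (0, k)) (\<rho> (Suc n, l)) q))"

definition old :: "'a \<Rightarrow> 'p \<Rightarrow> bool" where
  "old k p \<longleftrightarrow> (\<forall>q\<ge>p. \<not> new k q)"

text \<open>A failure of \<open>new\<close> at one condition may be repaired by an extension, and
  then the column would jump back. Values of \<open>shift\<close> are stable only from deciding
  conditions on, so it is always evaluated there.\<close>

definition decided :: "'a \<Rightarrow> 'p \<Rightarrow> bool" where
  "decided k p \<longleftrightarrow> new k p \<or> old k p"

text \<open>The real coded by \<open>(0, k)\<close> is used if it is new, and otherwise
  the whole column over \<open>k\<close> is shifted by one, as in Hilbert's hotel.\<close>

definition shift :: "'p \<Rightarrow> nat \<times> 'a \<Rightarrow> nat \<times> 'a" where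
  "shift p j = (if new (snd j) p then j else (Suc (fst j), snd j))"

lemma new_mono: "new k p \<Longrightarrow> p \<le> q \<Longrightarrow> new k q"
  unfolding new_def by (meson order_trans)

lemma old_mono: "old k p \<Longrightarrow> p \<le> q \<Longrightarrow> old k q"
  unfolding old_def by (meson order_trans)

lemma decided_mono: "decided k p \<Longrightarrow> p \<le> q \<Longrightarrow> decided k q"
  unfolding decided_def using new_mono old_mono by blast

lemma decided_dense: "\<exists>q\<ge>p. decided k q"
  unfolding decided_def old_def by blast

lemma shift_mono: "decided (snd j) p \<Longrightarrow> p \<le> q \<Longrightarrow> shift q j = shift p j"
  unfolding decided_def old_def shift_def using new_mono by auto

text \<open>A positive entry is never lost: its preimage is itself in a fixed column and its
  predecessor in a shifted one.\<close>

lemma shift_Suc: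
  assumes "k \<in> Field r"
  shows "\<exists>q\<ge>p. \<exists>j\<in>UNIV \<times> Field r. decided (snd j) q \<and> shift q j = (Suc n, k)"
proof -
  obtain q where q: "p \<le> q" "decided k q" using decided_dense by blast
  show ?thesis
  proof (cases "new k q")
    case True
    then show ?thesis
      using q assms by (intro exI[of _ q] conjI bexI[of _ "(Suc n, k)"]) (auto simp: shift_def)
  next
    case False
    then show ?thesis
      using q assms by (intro exI[of _ q] conjI bexI[of _ "(n, k)"]) (auto simp: shift_def)
  qed
qed

text \<open>If \<open>(0, k)\<close> is not new, some extension identifies its real with a positive
  entry, which \<open>shift_Suc\<close> reaches, or with \<open>(0, l)\<close> for an earlier
  \<open>l\<close>, where the induction along \<open>r\<close> continues.\<close>

lemma shift_zero:
  assumes "k \<in> Field r"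
  shows "\<exists>q\<ge>p. \<exists>j\<in>UNIV \<times> Field r. decided (snd j) q \<and> forces_eq (\<rho> (0, k)) (\<rho> (shift q j)) q"
proof -
  have "wf (r - Id)" using well_order by (simp add: well_order_on_def)
  then show ?thesis using assms
  proof (induction k arbitrary: p rule: wf_induct_rule)
    case (less k)
    show ?case
    proof (cases "new k p")
      case True
      then show ?thesis
        using less.prems forces_eq_refl
        by (intro exI[of _ p] conjI bexI[of _ "(0, k)"]) (auto simp: shift_def decided_def)
    next
      case False
      then obtain q j where q: "p \<le> q" "forces_eq (\<rho> (0, k)) (\<rho> j) q"
        and j: "(\<exists>l\<in>underS r k. j = (0, l)) \<or> (\<exists>n. \<exists>l\<in>Field r. j = (Suc n, l))"
        unfolding new_def by blast
      have "\<exists>s\<ge>q. \<exists>j'\<in>UNIV \<times> Field r. decided (snd j') s \<and> forces_eq (\<rho> j) (\<rho> (shift s j')) s"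
        using j
      proof (elim disjE bexE exE)
        fix l assume "l \<in> underS r k" "j = (0, l)"
        moreover from this have "(l, k) \<in> r - Id" "l \<in> Field r"
          by (auto simp: underS_def Field_def)
        ultimately show ?thesis using less.IH by blast
      next
        fix n l assume "l \<in> Field r" "j = (Suc n, l)"
        then show ?thesis using shift_Suc[of l q n] forces_eq_refl by metis
      qed
      then obtain s j' where s: "q \<le> s" "j' \<in> UNIV \<times> Field r" "decided (snd j') s"
        "forces_eq (\<rho> j) (\<rho> (shift s j')) s" by blast
      then have "forces_eq (\<rho> (0, k)) (\<rho> (shift s j')) s"
        using forces_eq_trans forces_eq_mono[OF q(2)] by blast
      then show ?thesis using s q(1) order_trans by blast
    qed
  qed
qed

lemma shift_surj:
  assumes "k \<in> Field r"
  shows "\<exists>q\<ge>p. \<exists>j\<in>UNIV \<times> Field r. decided (snd j) q \<and> forces_eq (\<rho> (n, k)) (\<rho> (shift q j)) q"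
proof (cases n)
  case 0
  then show ?thesis using shift_zero assms by blast
next
  case (Suc m)
  then show ?thesis using shift_Suc[OF assms, of p m] forces_eq_refl by metis
qed

text \<open>A value with first index 0 occurs only in a new column, and newness excludes equality
  with positive entries and with earlier codes. Two positive values are separated by
  \<open>Suc_distinct\<close>, and \<open>shift\<close> itself is injective on indices.\<close>

lemma shift_inj:
  assumes ij: "i \<in> UNIV \<times> Field r" "j \<in> UNIV \<times> Field r"
    and dec: "decided (snd i) p" "decided (snd j) p"
    and eq: "forces_eq (\<rho> (shift p i)) (\<rho> (shift p j)) p"
  shows "i = j"
proof -
  have new_Suc: False if "new k p" "l \<in> Field r" "forces_eq (\<rho> (0, k)) (\<rho> (Suc n, l)) p" for k l n
    using that unfolding new_def by blast
  have zero: "new (snd i) p" if "shift p i = (0, k)" for i k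
    using that by (auto simp: shift_def split: if_splits)
  obtain m k n l where s: "shift p i = (m, k)" "shift p j = (n, l)" by fastforce
  then have ki: "k = snd i" "l = snd j" "k \<in> Field r" "l \<in> Field r"
    using ij by (auto simp: shift_def split: if_splits)
  have mn: "(m, k) = (n, l)"
  proof (cases m; cases n)
    fix n' assume "m = 0" "n = Suc n'"
    then show ?thesis using new_Suc[of k l n'] zero[of i k] s ki eq by auto
  next
    fix m' assume "m = Suc m'" "n = 0"
    then show ?thesis using new_Suc[of l k m'] zero[of j l] s ki forces_eq_sym[OF eq] by auto
  next
    fix m' n' assume "m = Suc m'" "n = Suc n'"
    then show ?thesis using Suc_distinct[of m' k n' l p] s ki eq by auto
  next
    assume 0: "m = 0" "n = 0"
    then have "new k p" "new l p" using zero s ki by auto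
    then have "k \<notin> underS r l" "l \<notin> underS r k"
      using eq forces_eq_sym[OF eq] order_refl[of p] unfolding new_def s 0 by blast+
    then have "k = l"
      using well_order ki by (auto simp: order_on_defs total_on_def underS_def)
    then show ?thesis using 0 by simp
  qed
  then show ?thesis
    using s ki by (cases i; cases j) (auto simp: shift_def split: if_splits)
qed

section \<open>Names for the power set and for the bijection\<close>

definition reals_name :: "('i, 'p) name" where
  "reals_name = mk_name ((\<lambda>j. (\<rho> j, bot)) ` (UNIV \<times> Field r))"

text \<open>All deciding conditions are listed instead of a maximal antichain. This creates no
  conflict: by \<open>shift_mono\<close>, two compatible deciding conditions agree on the value of
  \<open>shift\<close> for the same \<open>l\<close>.\<close>

definition bijection_name :: "('i, 'p) name" where
  "bijection_name = mk_name ((\<lambda>(l, p). (pair_name (\<rho> (shift p (d l))) (segment_name r l), p)) `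
     {(l, p). l \<in> Field r \<and> decided (snd (d l)) p})"

lemma elems_reals_name: "elems reals_name = (\<lambda>j. (\<rho> j, bot)) ` (UNIV \<times> Field r)"
  unfolding reals_name_def
proof (rule elems_mk_name)
  have "|(\<lambda>j. (\<rho> j, bot :: 'p)) ` (UNIV \<times> Field r)| \<le>o |UNIV \<times> Field r :: (nat \<times> 'a) set|"
    by (rule card_of_image)
  also have "|UNIV \<times> Field r :: (nat \<times> 'a) set| =o |Field r|"
    using d by (meson card_of_ordIso ordIso_symmetric)
  finally show "|(\<lambda>j. (\<rho> j, bot :: 'p)) ` (UNIV \<times> Field r)| \<le>o |UNIV :: 'i set|"
    using Field_size by (rule ordLeq_transitive)
qed

lemma elems_bijection_name: "elems bijection_name =
    (\<lambda>(l, p). (pair_name (\<rho> (shift p (d l))) (segment_name r l), p)) `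
      {(l, p). l \<in> Field r \<and> decided (snd (d l)) p}"
  (is "_ = ?f ` ?S")
  unfolding bijection_name_def
proof (rule elems_mk_name)
  have "|?f ` ?S| \<le>o |?S|" by (rule card_of_image)
  also have "|?S| \<le>o |Field r \<times> (UNIV :: 'p set)|" by (rule card_of_mono1) auto
  finally show "|?f ` ?S| \<le>o |UNIV :: 'i set|" using size by (rule ordLeq_transitive)
qed

lemma Mem_reals_nameE:
  assumes "(x \<^bold>\<in> reals_name) p"
  obtains q n k where "p \<le> q" "k \<in> Field r" "forces_eq x (\<rho> (n, k)) q"
  using assms by (elim MemE) (auto simp: elems_reals_name)

lemma Mem_reals_nameI:
  assumes "forces_eq x (\<rho> (n, k)) p" "k \<in> Field r"
  shows "(x \<^bold>\<in> reals_name) p"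
proof -
  have "(\<rho> (n, k), bot) \<in> elems reals_name" using assms by (auto simp: elems_reals_name)
  from Mem_elem[OF this, of p] show ?thesis
    using Mem_cong_left forces_eq_sym[OF assms(1)] by auto
qed

lemma Mem_ordinal_nameE:
  assumes "(y \<^bold>\<in> ordinal_name r) (p :: 'p)"
  obtains q l where "p \<le> q" "l \<in> Field r" "forces_eq y (segment_name r l :: ('i, 'p) name) q"
  using assms by (elim MemE) (auto simp: elems_ordinal_name[OF Field_size])

lemma Mem_ordinal_nameI:
  assumes "forces_eq y (segment_name r l :: ('i, 'p) name) p" "l \<in> Field r"
  shows "(y \<^bold>\<in> ordinal_name r) p"
proof -
  have "(segment_name r l, bot) \<in> elems (ordinal_name r :: ('i, 'p) name)"
    using assms by (auto simp: elems_ordinal_name[OF Field_size])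
  from Mem_elem[OF this, of p] show ?thesis
    using Mem_cong_left forces_eq_sym[OF assms(1)] by auto
qed

lemma Mem_bijection_nameE:
  assumes "(u \<^bold>\<in> bijection_name) p"
  obtains q l where "p \<le> q" "l \<in> Field r" "decided (snd (d l)) q"
    "forces_eq u (pair_name (\<rho> (shift q (d l))) (segment_name r l)) q"
proof -
  obtain w q where w: "w \<in> elems bijection_name" "p \<le> q" "snd w \<le> q" "forces_eq u (fst w) q"
    using assms by (rule MemE)
  then obtain l where l: "l \<in> Field r" "decided (snd (d l)) (snd w)"
    "fst w = pair_name (\<rho> (shift (snd w) (d l))) (segment_name r l)"
    by (auto simp: elems_bijection_name)
  then have "decided (snd (d l)) q" "shift q (d l) = shift (snd w) (d l)"
    using w decided_mono shift_mono by blast+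
  then show ?thesis using that w l by metis
qed

lemma pair_in_bijection_nameI:
  assumes "l \<in> Field r" "decided (snd (d l)) p"
    and "forces_eq x (\<rho> (shift p (d l))) p" "forces_eq y (segment_name r l) p"
  shows "pair_in x y bijection_name p"
proof -
  have "(pair_name (\<rho> (shift p (d l))) (segment_name r l), p) \<in> elems bijection_name"
    unfolding elems_bijection_name using assms by auto
  from Mem_elem[OF this, of p] have "(pair_name (\<rho> (shift p (d l))) (segment_name r l) \<^bold>\<in> bijection_name) p"
    by simp
  then show ?thesis
    unfolding pair_in_eq[OF infinite_index]
    using Mem_cong_left pair_name_cong[OF infinite_index] assms(3,4) forces_eq_sym by metis
qed

lemma pair_in_bijection_nameE:
  assumes "pair_in x y bijection_name p"
  obtains q l where "p \<le> q" "l \<in> Field r" "decided (snd (d l)) q"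
    "forces_eq x (\<rho> (shift q (d l))) q" "forces_eq y (segment_name r l) q"
proof -
  obtain q l where q: "p \<le> q" "l \<in> Field r" "decided (snd (d l)) q"
    "forces_eq (pair_name x y) (pair_name (\<rho> (shift q (d l))) (segment_name r l)) q"
    using assms[unfolded pair_in_eq[OF infinite_index]] by (rule Mem_bijection_nameE)
  show ?thesis
    using q(1-3) pair_name_eq_fst[OF infinite_index q(4)] pair_name_eq_snd[OF infinite_index q(4)]
    by (rule that)
qed

lemma pair_in_bijection_name_mono:
  "pair_in x y bijection_name p \<Longrightarrow> p \<le> q \<Longrightarrow> pair_in x y bijection_name q"
  unfolding pair_in_eq[OF infinite_index] by (rule Mem_mono)

lemma pairs_in_bijection_nameE:
  assumes "(pair_in x y bijection_name \<^bold>\<and> pair_in x' y' bijection_name) p"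
  obtains q l l' where "p \<le> q" "l \<in> Field r" "l' \<in> Field r"
    "decided (snd (d l)) q" "decided (snd (d l')) q"
    "forces_eq x (\<rho> (shift q (d l))) q" "forces_eq y (segment_name r l) q"
    "forces_eq x' (\<rho> (shift q (d l'))) q" "forces_eq y' (segment_name r l') q"
proof -
  have 1: "pair_in x y bijection_name p" "pair_in x' y' bijection_name p"
    using assms by (auto simp: Conj_def)
  obtain q l where q: "p \<le> q" "l \<in> Field r" "decided (snd (d l)) q"
    "forces_eq x (\<rho> (shift q (d l))) q" "forces_eq y (segment_name r l) q"
    using 1(1) by (rule pair_in_bijection_nameE)
  obtain s l' where s: "q \<le> s" "l' \<in> Field r" "decided (snd (d l')) s"
    "forces_eq x' (\<rho> (shift s (d l'))) s" "forces_eq y' (segment_name r l') s"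
    using pair_in_bijection_name_mono[OF 1(2) q(1)] by (rule pair_in_bijection_nameE)
  show ?thesis
  proof (rule that[of s l l'])
    show "p \<le> s" using q(1) s(1) by (rule order_trans)
    show "decided (snd (d l)) s" using q(3) s(1) by (rule decided_mono)
    show "forces_eq x (\<rho> (shift s (d l))) s" "forces_eq y (segment_name r l) s"
      using q s(1) forces_eq_mono shift_mono by metis+
  qed (use q s in auto)
qed

lemma d_Field: "l \<in> Field r \<Longrightarrow> d l \<in> UNIV \<times> Field r"
  using d by (auto simp: bij_betw_def)

lemma is_powerset_reals_name: "is_powerset reals_name (ordinal_name natLeq) p"
proof -
  have "(x \<^bold>\<in> reals_name) p \<longleftrightarrow> is_subset x (ordinal_name natLeq) p" for x p
  proof
    assume x: "(x \<^bold>\<in> reals_name) p"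
    show "is_subset x (ordinal_name natLeq) p"
    proof (rule is_subset_dense)
      fix q assume "p \<le> q"
      then obtain s n k where "q \<le> s" "k \<in> Field r" "forces_eq x (\<rho> (n, k)) s"
        using Mem_mono[OF x] Mem_reals_nameE by blast
      then show "\<exists>s\<ge>q. is_subset x (ordinal_name natLeq) s"
        using subset_omega is_subset_cong_left forces_eq_sym by blast
    qed
  next
    assume x: "is_subset x (ordinal_name natLeq) p"
    show "(x \<^bold>\<in> reals_name) p"
    proof (rule Mem_dense)
      fix q assume "p \<le> q"
      then obtain s k where "q \<le> s" "k \<in> Field r" "forces_eq x (\<rho> (0, k)) s"
        using is_subset_mono[OF x] exhaustive by blast
      then show "\<exists>s\<ge>q. (x \<^bold>\<in> reals_name) s" using Mem_reals_nameI by blast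
    qed
  qed
  then have "(\<lambda>x. x \<^bold>\<in> reals_name) = (\<lambda>x. is_subset x (ordinal_name natLeq))" by blast
  then show ?thesis
    unfolding is_powerset_def All_names_def Iff_def Conj_def Imp_iff by (metis order_refl)
qed

lemma is_bijection_bijection_name: "is_bijection bijection_name reals_name (ordinal_name r) p"
  unfolding is_bijection_def
proof (unfold Conj_All_names_iff All_names_iff, intro conjI allI)
  fix u
  show "(u \<^bold>\<in> bijection_name \<^bold>\<longrightarrow>
      (\<^bold>\<exists>x y. x \<^bold>\<in> reals_name \<^bold>\<and> y \<^bold>\<in> ordinal_name r \<^bold>\<and> is_pair u x y)) p"
    unfolding Imp_iff
  proof (intro allI impI)
    fix q assume "(u \<^bold>\<in> bijection_name) q"
    then obtain s l where s: "q \<le> s" "l \<in> Field r"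
      "forces_eq u (pair_name (\<rho> (shift s (d l))) (segment_name r l)) s"
      by (rule Mem_bijection_nameE)
    define x where "x = \<rho> (shift s (d l))"
    define y :: "('i, 'p) name" where "y = segment_name r l"
    have "(x \<^bold>\<in> reals_name \<^bold>\<and> y \<^bold>\<in> ordinal_name r \<^bold>\<and> is_pair u x y) t" if "s \<le> t" for t
    proof -
      have "snd (shift s (d l)) \<in> Field r" using d_Field[OF s(2)] by (auto simp: shift_def)
      then have "(x \<^bold>\<in> reals_name) t" unfolding x_def
        by (metis Mem_reals_nameI forces_eq_refl prod.collapse)
      moreover have "(y \<^bold>\<in> ordinal_name r) t"
        unfolding y_def using s(2) by (rule Mem_ordinal_nameI[OF forces_eq_refl])
      ultimately show ?thesis
        using forces_eq_mono[OF s(3) that]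
        by (simp add: Conj_def is_pair_eq[OF infinite_index] Eq_def x_def y_def)
    qed
    then have "(\<^bold>\<exists>x y. x \<^bold>\<in> reals_name \<^bold>\<and> y \<^bold>\<in> ordinal_name r \<^bold>\<and> is_pair u x y) s"
      unfolding Ex_name_iff by (meson order_refl order_trans)
    with s(1) show "\<exists>s\<ge>q. (\<^bold>\<exists>x y. x \<^bold>\<in> reals_name \<^bold>\<and> y \<^bold>\<in> ordinal_name r \<^bold>\<and> is_pair u x y) s"
      by blast
  qed
next
  fix x
  show "(x \<^bold>\<in> reals_name \<^bold>\<longrightarrow> (\<^bold>\<exists>y. pair_in x y bijection_name)) p"
    unfolding Imp_iff
  proof (intro allI impI)
    fix q assume "(x \<^bold>\<in> reals_name) q"
    then obtain s n k where s: "q \<le> s" "k \<in> Field r" "forces_eq x (\<rho> (n, k)) s"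
      by (rule Mem_reals_nameE)
    obtain t j where t: "s \<le> t" "j \<in> UNIV \<times> Field r" "decided (snd j) t"
      "forces_eq (\<rho> (n, k)) (\<rho> (shift t j)) t"
      using shift_surj[OF s(2)] by blast
    obtain l where l: "l \<in> Field r" "d l = j"
      using t(2) d unfolding bij_betw_def by (metis imageE)
    have "pair_in x (segment_name r l) bijection_name t"
      using l t forces_eq_trans[OF forces_eq_mono[OF s(3)]] forces_eq_refl
      by (intro pair_in_bijection_nameI[of l]) auto
    then have "(\<^bold>\<exists>y. pair_in x y bijection_name) t"
      unfolding Ex_name_iff using pair_in_bijection_name_mono by blast
    with s(1) t(1) show "\<exists>s\<ge>q. (\<^bold>\<exists>y. pair_in x y bijection_name) s"
      using order_trans by blast
  qed
next
  fix x y y'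
  show "(pair_in x y bijection_name \<^bold>\<and> pair_in x y' bijection_name \<^bold>\<longrightarrow> y \<^bold>= y') p"
    unfolding Imp_iff
  proof (intro allI impI)
    fix q assume "(pair_in x y bijection_name \<^bold>\<and> pair_in x y' bijection_name) q"
    then obtain s l l' where s: "q \<le> s" "l \<in> Field r" "l' \<in> Field r"
      "decided (snd (d l)) s" "decided (snd (d l')) s"
      "forces_eq x (\<rho> (shift s (d l))) s" "forces_eq y (segment_name r l) s"
      "forces_eq x (\<rho> (shift s (d l'))) s" "forces_eq y' (segment_name r l') s"
      by (rule pairs_in_bijection_nameE)
    have "d l = d l'"
      using s d_Field forces_eq_trans[OF forces_eq_sym[OF s(6)] s(8)] by (intro shift_inj) auto
    then have "l = l'" using d s by (auto simp: bij_betw_def inj_on_def)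
    then show "\<exists>s\<ge>q. (y \<^bold>= y') s"
      unfolding Eq_def using s forces_eq_trans forces_eq_sym by blast
  qed
next
  fix y
  show "(y \<^bold>\<in> ordinal_name r \<^bold>\<longrightarrow> (\<^bold>\<exists>x. pair_in x y bijection_name)) p"
    unfolding Imp_iff
  proof (intro allI impI)
    fix q assume "(y \<^bold>\<in> ordinal_name r) q"
    then obtain s l where s: "q \<le> s" "l \<in> Field r" "forces_eq y (segment_name r l) s"
      by (rule Mem_ordinal_nameE)
    obtain t where t: "s \<le> t" "decided (snd (d l)) t" using decided_dense by blast
    have "pair_in (\<rho> (shift t (d l))) y bijection_name t"
      using s t forces_eq_mono forces_eq_refl by (intro pair_in_bijection_nameI[of l]) auto
    then have "(\<^bold>\<exists>x. pair_in x y bijection_name) t"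
      unfolding Ex_name_iff using pair_in_bijection_name_mono by blast
    with s(1) t(1) show "\<exists>s\<ge>q. (\<^bold>\<exists>x. pair_in x y bijection_name) s"
      using order_trans by blast
  qed
next
  fix x x' y
  show "(pair_in x y bijection_name \<^bold>\<and> pair_in x' y bijection_name \<^bold>\<longrightarrow> x \<^bold>= x') p"
    unfolding Imp_iff
  proof (intro allI impI)
    fix q assume "(pair_in x y bijection_name \<^bold>\<and> pair_in x' y bijection_name) q"
    then obtain s l l' where s: "q \<le> s" "l \<in> Field r" "l' \<in> Field r"
      "decided (snd (d l)) s" "decided (snd (d l')) s"
      "forces_eq x (\<rho> (shift s (d l))) s" "forces_eq y (segment_name r l) s"
      "forces_eq x' (\<rho> (shift s (d l'))) s" "forces_eq y (segment_name r l') s"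
      by (rule pairs_in_bijection_nameE)
    have "l = l'"
      using segment_name_eq_imp_eq[OF well_order Field_size s(2,3)]
        forces_eq_trans[OF forces_eq_sym[OF s(7)] s(9)] by blast
    then show "\<exists>s\<ge>q. (x \<^bold>= x') s"
      unfolding Eq_def using s forces_eq_trans forces_eq_sym by blast
  qed
qed

theorem continuum_is_card_of_ordinal_name: "continuum_is_card_of (ordinal_name r :: ('i, 'p) name) p"
proof -
  have "same_cardinality reals_name (ordinal_name r) q" for q
    unfolding same_cardinality_def Ex_name_iff
    using is_bijection_bijection_name by blast
  then show ?thesis
    unfolding continuum_is_card_of_def Ex_name_iff Conj_def
    using is_powerset_reals_name by blast
qed

end

subsection \<open>Fusion and collapse for Silver forcing\<close>

lemma infinite_free: "infinite (- dom (fun_of p))"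
  using fun_of[of p] by simp

lemma fun_of_Silver: "infinite (- dom f) \<Longrightarrow> fun_of (Silver f) = f"
  by (simp add: Silver_inverse)

lemma silver_le_dom: "p \<le> q \<Longrightarrow> dom (fun_of p) \<subseteq> dom (fun_of q)"
  unfolding less_eq_silver_def by (rule map_le_implies_dom_le)

lemma silver_le_app: "p \<le> q \<Longrightarrow> fun_of p x = Some b \<Longrightarrow> fun_of q x = Some b"
  unfolding less_eq_silver_def map_le_def by (metis domI)

lemma silver_leI: "(\<And>x b. fun_of p x = Some b \<Longrightarrow> fun_of q x = Some b) \<Longrightarrow> p \<le> q"
  by (auto simp: less_eq_silver_def map_le_def)

definition set_value :: "silver \<Rightarrow> nat \<Rightarrow> bool \<Rightarrow> silver" where
  "set_value p x b = Silver ((fun_of p)(x \<mapsto> b))"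

definition unset_value :: "silver \<Rightarrow> nat \<Rightarrow> silver" where
  "unset_value p x = Silver ((fun_of p)(x := None))"

lemma fun_of_set_value: "fun_of (set_value p x b) = (fun_of p)(x \<mapsto> b)"
proof -
  have "- dom ((fun_of p)(x \<mapsto> b)) = - dom (fun_of p) - {x}" by auto
  then show ?thesis unfolding set_value_def by (simp add: fun_of_Silver infinite_free)
qed

lemma fun_of_unset_value: "fun_of (unset_value p x) = (fun_of p)(x := None)"
proof -
  have "- dom (fun_of p) \<subseteq> - dom ((fun_of p)(x := None))" by auto
  then show ?thesis
    unfolding unset_value_def by (metis fun_of_Silver infinite_free infinite_super)
qed

lemma set_value_le:
  assumes "unset_value p x \<le> q" "fun_of q x = Some b" "fun_of p x = Some b"
  shows "p \<le> q"
proof (rule silver_leI)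
  fix y c assume "fun_of p y = Some c"
  then show "fun_of q y = Some c"
    using assms silver_le_app[OF assms(1), of y c]
    by (cases "y = x") (simp_all add: fun_of_unset_value)
qed

lemma extension_domain:
  assumes "finite a"
  shows "\<exists>q\<ge>p. a \<subseteq> dom (fun_of q)"
proof -
  define f where "f = (\<lambda>x. if x \<in> a - dom (fun_of p) then Some False else fun_of p x)"
  have "- dom f = - dom (fun_of p) - a" by (auto simp: f_def split: if_splits)
  then have "fun_of (Silver f) = f" using assms by (simp add: fun_of_Silver infinite_free)
  then show ?thesis
    by (intro exI[of _ "Silver f"]) (auto simp: less_eq_silver_def map_le_def f_def)
qed

text \<open>Each point of \<open>a\<close> receives both truth values in turn: fix the value,
  strengthen the condition by the induction hypothesis, free the point again. In the end every
  extension that is total on \<open>a\<close> lies above the condition treated for its own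
  assignment, whatever that assignment is.\<close>

lemma decide_finite:
  assumes "finite a" "a \<inter> dom (fun_of p) = {}" and "\<And>p. \<exists>q\<ge>p. \<forall>r\<ge>q. D r"
  shows "\<exists>q\<ge>p. a \<inter> dom (fun_of q) = {} \<and> (\<forall>r\<ge>q. a \<subseteq> dom (fun_of r) \<longrightarrow> D r)"
  using assms(1,2)
proof (induction a arbitrary: p rule: finite_induct)
  case empty
  then show ?case using assms(3) by blast
next
  case (insert x a)
  have step: "\<exists>q\<ge>p. insert x a \<inter> dom (fun_of q) = {} \<and>
      (\<forall>r\<ge>q. insert x a \<subseteq> dom (fun_of r) \<longrightarrow> fun_of r x = Some b \<longrightarrow> D r)"
    if p: "insert x a \<inter> dom (fun_of p) = {}" for p b
  proof -
    have "a \<inter> dom (fun_of (set_value p x b)) = {}"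
      using p insert.hyps by (auto simp: fun_of_set_value)
    then obtain q where q: "set_value p x b \<le> q" "a \<inter> dom (fun_of q) = {}"
      "\<forall>r\<ge>q. a \<subseteq> dom (fun_of r) \<longrightarrow> D r"
      using insert.IH by blast
    have qx: "fun_of q x = Some b"
      using silver_le_app[OF q(1)] by (simp add: fun_of_set_value)
    have "p \<le> unset_value q x"
      using q(1) p unfolding less_eq_silver_def map_le_def
      by (auto simp: fun_of_set_value fun_of_unset_value dom_def)
    moreover have "insert x a \<inter> dom (fun_of (unset_value q x)) = {}"
      using q(2) by (auto simp: fun_of_unset_value)
    moreover have "D r" if "unset_value q x \<le> r" "insert x a \<subseteq> dom (fun_of r)" "fun_of r x = Some b" for r
      using set_value_le[OF that(1,3) qx] q(3) that(2) by blast
    ultimately show ?thesis by blast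
  qed
  obtain q where q: "p \<le> q" "insert x a \<inter> dom (fun_of q) = {}"
    "\<And>r. q \<le> r \<Longrightarrow> insert x a \<subseteq> dom (fun_of r) \<Longrightarrow> fun_of r x = Some False \<Longrightarrow> D r"
    using step[OF insert.prems, of False] by blast
  obtain q' where q': "q \<le> q'" "insert x a \<inter> dom (fun_of q') = {}"
    "\<And>r. q' \<le> r \<Longrightarrow> insert x a \<subseteq> dom (fun_of r) \<Longrightarrow> fun_of r x = Some True \<Longrightarrow> D r"
    using step[OF q(2), of True] by blast
  have "D r" if r: "q' \<le> r" "insert x a \<subseteq> dom (fun_of r)" for r
  proof -
    obtain b where "fun_of r x = Some b" using r(2) by auto
    then show ?thesis
      using q(3)[of r] q'(3)[of r] r order_trans[OF q'(1) r(1)] by (cases b) auto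
  qed
  then show ?case using q'(2) order_trans[OF q(1) q'(1)] by blast
qed

text \<open>A stage consists of a condition and a finite set of protected free points. At stage
  \<open>n\<close> the property \<open>D n\<close> is secured relative to all assignments to the
  protected points, and one more free point becomes protected. The union of the conditions leaves
  every protected point free.\<close>

lemma fusion:
  fixes D :: "nat \<Rightarrow> silver \<Rightarrow> bool"
  assumes dense: "\<And>n p. \<exists>q\<ge>p. \<forall>r\<ge>q. D n r"
  obtains q where "p \<le> q" "\<And>n. \<exists>a. finite a \<and> (\<forall>r\<ge>q. a \<subseteq> dom (fun_of r) \<longrightarrow> D n r)"
proof -
  \<comment> \<open>The lower bound on the cardinality makes the union of the protected sets
    infinite, which turns the limit into a legal condition.\<close>
  define ok where "ok n s \<longleftrightarrow> finite (snd s) \<and> n \<le> card (snd s) \<and> snd s \<inter> dom (fun_of (fst s)) = {}"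
    for n :: nat and s :: "silver \<times> nat set"
  define R where "R n s t \<longleftrightarrow> fst s \<le> fst t \<and> snd s \<subseteq> snd t \<and>
      (\<forall>r\<ge>fst t. snd s \<subseteq> dom (fun_of r) \<longrightarrow> D n r)" for n :: nat and s t :: "silver \<times> nat set"
  have "\<exists>s. \<forall>n. ok n (s n) \<and> fst (s n) \<ge> p \<and> R n (s n) (s (Suc n))"
  proof (rule dependent_nat_choice[where P = "\<lambda>n s. ok n s \<and> p \<le> fst s" and Q = R, simplified conj_assoc])
    show "\<exists>s. ok 0 s \<and> p \<le> fst s" by (intro exI[of _ "(p, {})"]) (simp add: ok_def)
  next
    fix s n assume s: "ok n s \<and> p \<le> fst s"
    then obtain q where q: "fst s \<le> q" "snd s \<inter> dom (fun_of q) = {}"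
      "\<forall>r\<ge>q. snd s \<subseteq> dom (fun_of r) \<longrightarrow> D n r"
      using decide_finite[of "snd s" "fst s" "D n"] dense unfolding ok_def by blast
    have "infinite (- dom (fun_of q) - snd s)"
      using s by (simp add: ok_def infinite_free)
    then obtain x where x: "x \<in> - dom (fun_of q) - snd s"
      using infinite_imp_nonempty by blast
    show "\<exists>t. ok (Suc n) t \<and> p \<le> fst t \<and> R n s t"
      using s q x order_trans by (intro exI[of _ "(q, insert x (snd s))"]) (auto simp: ok_def R_def)
  qed
  then obtain s where s: "\<And>n. ok n (s n)" "\<And>n. p \<le> fst (s n)" "\<And>n. R n (s n) (s (Suc n))" by blast
  have mono: "fst (s m) \<le> fst (s n) \<and> snd (s m) \<subseteq> snd (s n)" if "m \<le> n" for m n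
    using that
  proof (induction n rule: dec_induct)
    case (step n)
    then show ?case using s(3)[of n] unfolding R_def by (meson order_trans)
  qed simp
  define f where "f x = (if \<exists>n b. fun_of (fst (s n)) x = Some b
      then Some (SOME b. \<exists>n. fun_of (fst (s n)) x = Some b) else None)" for x
  have f: "f x = Some b" if "fun_of (fst (s n)) x = Some b" for n x b
  proof -
    have "c = b" if "fun_of (fst (s m)) x = Some c" for m c
    proof -
      have "fun_of (fst (s (max m n))) x = Some c" "fun_of (fst (s (max m n))) x = Some b"
        using mono[of m "max m n"] mono[of n "max m n"] silver_le_app that
          \<open>fun_of (fst (s n)) x = Some b\<close> by auto
      then show ?thesis by simp
    qed
    then have "(SOME b. \<exists>n. fun_of (fst (s n)) x = Some b) = b"
      using that by (intro some_equality) blast+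
    then show ?thesis using that by (auto simp: f_def)
  qed
  have free: "(\<Union>n. snd (s n)) \<subseteq> - dom f"
  proof
    fix x assume "x \<in> (\<Union>n. snd (s n))"
    then obtain n where n: "x \<in> snd (s n)" by blast
    have "fun_of (fst (s m)) x = None" for m
    proof -
      have "x \<notin> dom (fun_of (fst (s (max m n))))"
        using mono[of n "max m n"] n s(1)[of "max m n"] unfolding ok_def by auto
      then show ?thesis
        using mono[of m "max m n"] silver_le_dom[of "fst (s m)" "fst (s (max m n))"]
        by (auto simp: domIff)
    qed
    then show "x \<in> - dom f" by (auto simp: f_def)
  qed
  have "infinite (\<Union>n. snd (s n))"
  proof
    assume fin: "finite (\<Union>n. snd (s n))"
    define N where "N = Suc (card (\<Union>n. snd (s n)))"
    have "N \<le> card (snd (s N))" using s(1)[of N] by (simp add: ok_def)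
    also have "\<dots> \<le> card (\<Union>n. snd (s n))" using fin by (intro card_mono) auto
    finally show False by (simp add: N_def)
  qed
  then have Silver_f: "fun_of (Silver f) = f" using free by (meson fun_of_Silver infinite_super)
  have le: "fst (s n) \<le> Silver f" for n
    by (rule silver_leI) (simp add: Silver_f f)
  show ?thesis
  proof (rule that[of "Silver f"])
    show "p \<le> Silver f" using s(2)[of 0] le[of 0] by (rule order_trans)
    fix n
    show "\<exists>a. finite a \<and> (\<forall>r\<ge>Silver f. a \<subseteq> dom (fun_of r) \<longrightarrow> D n r)"
    proof (intro exI[of _ "snd (s n)"] conjI allI impI)
      show "finite (snd (s n))" using s(1) by (simp add: ok_def)
    next
      fix r assume r: "Silver f \<le> r" "snd (s n) \<subseteq> dom (fun_of r)"
      have "fst (s (Suc n)) \<le> r" using le r(1) by (rule order_trans)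
      then show "D n r" using s(3)[of n] r(2) unfolding R_def by blast
    qed
  qed
qed

section \<open>Branches of the binary tree and the intervals they select\<close>

definition branch :: "nat set \<Rightarrow> nat \<Rightarrow> nat" where
  "branch B i = (\<Sum>k\<in>B \<inter> {..<i}. 2 ^ k)"

lemma branch_Suc: "branch B (Suc i) = branch B i + (if i \<in> B then 2 ^ i else 0)"
proof (cases "i \<in> B")
  case True
  then have "B \<inter> {..<Suc i} = insert i (B \<inter> {..<i})" by auto
  then show ?thesis using True by (simp add: branch_def)
next
  case False
  then have "B \<inter> {..<Suc i} = B \<inter> {..<i}" by (auto simp: less_Suc_eq)
  then show ?thesis using False by (simp add: branch_def)
qed

lemma branch_less: "branch B i < 2 ^ i"
proof (induction i)
  case 0
  then show ?case by (simp add: branch_def)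
next
  case (Suc i)
  then show ?case by (simp add: branch_Suc)
qed

text \<open>\<open>branch B i\<close> reads the characteristic function of \<open>B\<close> below
  \<open>i\<close> as binary digits, least significant first. It numbers a node of level
  \<open>i\<close>, and reduction modulo \<open>2 ^ i\<close> takes a higher node to its predecessor
  of level \<open>i\<close>.\<close>

lemma branch_mod: "i \<le> j \<Longrightarrow> branch B j mod 2 ^ i = branch B i"
proof (induction j rule: dec_induct)
  case base
  then show ?case by (simp add: branch_less)
next
  case (step j)
  have "(2 :: nat) ^ i dvd 2 ^ j" using step.hyps by (simp add: le_imp_power_dvd)
  then show ?case using step.IH by (auto simp: branch_Suc)
qed

text \<open>Agreement at one level passes to all lower levels by \<open>branch_mod\<close>, so
  agreement at infinitely many levels is agreement at all of them.\<close>

lemma branch_inj: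
  assumes "\<exists>\<^sub>\<infinity>i. branch B i = branch C i"
  shows "B = C"
proof -
  have eq: "branch B i = branch C i" for i
  proof -
    obtain j where "j \<ge> i" "branch B j = branch C j"
      using assms unfolding INFM_nat_le by blast
    then show ?thesis by (metis branch_mod)
  qed
  have "i \<in> B \<longleftrightarrow> i \<in> C" for i
    using eq[of i] eq[of "Suc i"] by (auto simp: branch_Suc split: if_splits)
  then show ?thesis by blast
qed

text \<open>The number \<open>2 ^ i + j\<close> with \<open>j < 2 ^ i\<close> is the heap numbering
  of node \<open>j\<close> on level \<open>i\<close>; the block is the interval of \<open>X\<close>
  with the number of the node of \<open>B\<close> on that level.\<close>

definition block :: "nat set \<Rightarrow> nat set \<Rightarrow> nat \<Rightarrow> nat set" where
  "block X B i = {enumerate X (2 ^ i + branch B i)..<enumerate X (2 ^ i + branch B i + 1)}"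

definition blocks :: "nat set \<Rightarrow> nat set \<Rightarrow> nat set" where
  "blocks X B = (\<Union>i. block X B i)"

text \<open>Intervals with different numbers are disjoint, and a number determines its node: it lies
  between \<open>2 ^ i\<close> and \<open>2 ^ Suc i\<close>, which gives the level, and the
  remainder gives the branch.\<close>

lemma block_index:
  assumes X: "infinite X" and "x \<in> block X B i" "x \<in> block X C j"
  shows "i = j \<and> branch B i = branch C j"
proof -
  have lt: "m \<le> n" if "enumerate X m \<le> x" "x < enumerate X (n + 1)" for m n
  proof -
    have "enumerate X m < enumerate X (n + 1)" using that by (rule le_less_trans)
    then have "m < n + 1" unfolding enumerate_mono_iff[OF X] .
    then show ?thesis by simp
  qed
  have eq: "2 ^ i + branch B i = 2 ^ j + branch C j"
    using lt[of "2 ^ i + branch B i" "2 ^ j + branch C j"]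
      lt[of "2 ^ j + branch C j" "2 ^ i + branch B i"] assms(2,3)
    unfolding block_def atLeastLessThan_iff by (blast intro: order_antisym)
  have less: False if "i < j" "2 ^ i + branch B i = 2 ^ j + branch C j" for i j B C
  proof -
    have "2 ^ i + branch B i < 2 ^ Suc i" using branch_less[of B i] by simp
    also have "(2 :: nat) ^ Suc i \<le> 2 ^ j" using that(1) by (intro power_increasing) auto
    finally show False using that(2) by simp
  qed
  then have "i = j" using eq less[of i j B C] less[of j i C B] by (metis nat_neq_iff)
  then show ?thesis using eq by simp
qed

text \<open>Different branches share only finitely many nodes, and each block is finite.\<close>

lemma finite_blocks_Int:
  assumes X: "infinite X" and "B \<noteq> C"
  shows "finite (blocks X B \<inter> blocks X C)"
proof -
  have "finite {i. branch B i = branch C i}"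
    using branch_inj[of B C] assms(2) unfolding INFM_iff_infinite by blast
  then have "finite (\<Union>i\<in>{i. branch B i = branch C i}. block X B i)"
    by (auto simp: block_def)
  moreover have "blocks X B \<inter> blocks X C \<subseteq> (\<Union>i\<in>{i. branch B i = branch C i}. block X B i)"
  proof
    fix x assume "x \<in> blocks X B \<inter> blocks X C"
    then obtain i j where "x \<in> block X B i" "x \<in> block X C j" by (auto simp: blocks_def)
    with block_index[OF X this] show "x \<in> (\<Union>i\<in>{i. branch B i = branch C i}. block X B i)"
      by auto
  qed
  ultimately show ?thesis by (rule finite_subset[rotated])
qed

section \<open>Thinning a condition along a branch\<close>

definition hits :: "nat set \<Rightarrow> silver \<Rightarrow> bool" where
  "hits X p \<longleftrightarrow> infinite X \<and> (\<exists>\<^sub>\<infinity>i. \<forall>j<2 ^ i.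
     card ({enumerate X (2 ^ i + j)..<enumerate X (2 ^ i + j + 1)} \<inter> - dom (fun_of p)) \<ge> 2)"

lemma weakly_dominating_hits: "weakly_dominating F \<Longrightarrow> \<exists>X\<in>F. hits X p"
  unfolding weakly_dominating_def hits_def using infinite_free by blast

text \<open>The filling value \<open>False\<close> is arbitrary: incompatibility comes from the lack
  of common free points, never from conflicting values.\<close>

definition thin :: "nat set \<Rightarrow> nat set \<Rightarrow> silver \<Rightarrow> silver" where
  "thin X B p = Silver (\<lambda>x. if x \<in> blocks X B \<union> dom (fun_of p) then fun_of p x else Some False)"

text \<open>Ensures that thinning produces a condition. On each good level all \<open>2 ^ i\<close>
  intervals contain free points, so the one on the branch does, wherever the branch runs; blocks of
  different levels are disjoint.\<close>

lemma infinite_free_blocks: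
  assumes "hits X p"
  shows "infinite (blocks X B \<inter> - dom (fun_of p))"
proof -
  have X: "infinite X" using assms by (simp add: hits_def)
  define I where "I = {i. \<forall>j<2 ^ i.
     card ({enumerate X (2 ^ i + j)..<enumerate X (2 ^ i + j + 1)} \<inter> - dom (fun_of p)) \<ge> 2}"
  have "\<exists>x. x \<in> block X B i \<inter> - dom (fun_of p)" if "i \<in> I" for i
  proof -
    have "card (block X B i \<inter> - dom (fun_of p)) \<ge> 2"
      using that branch_less[of B i] unfolding I_def block_def by blast
    then show ?thesis by (metis card.empty equals0I not_numeral_le_zero)
  qed
  then obtain g where g: "\<And>i. i \<in> I \<Longrightarrow> g i \<in> block X B i \<inter> - dom (fun_of p)" by metis
  have "infinite I" using assms by (simp add: hits_def I_def INFM_iff_infinite)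
  moreover have "inj_on g I"
    using g block_index[OF X] by (intro inj_onI) (metis IntE)
  ultimately have "infinite (g ` I)" by (simp add: finite_image_iff)
  moreover have "g ` I \<subseteq> blocks X B \<inter> - dom (fun_of p)" using g by (auto simp: blocks_def)
  ultimately show ?thesis by (rule infinite_super[rotated])
qed

lemma fun_of_thin:
  assumes "hits X p"
  shows "fun_of (thin X B p) = (\<lambda>x. if x \<in> blocks X B \<union> dom (fun_of p) then fun_of p x else Some False)"
  unfolding thin_def
proof (rule fun_of_Silver)
  have "- dom (\<lambda>x. if x \<in> blocks X B \<union> dom (fun_of p) then fun_of p x else Some False) =
      blocks X B \<inter> - dom (fun_of p)"
    by (auto split: if_splits)
  then show "infinite (- dom (\<lambda>x. if x \<in> blocks X B \<union> dom (fun_of p) then fun_of p x else Some False))"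
    using infinite_free_blocks[OF assms] by simp
qed

lemma thin_le: "hits X p \<Longrightarrow> p \<le> thin X B p"
  by (auto simp: less_eq_silver_def map_le_def fun_of_thin)

lemma thin_compatible:
  assumes "hits X p" "hits X q" "thin X B p \<le> r" "thin X C q \<le> r"
  shows "B = C"
proof (rule ccontr)
  assume "B \<noteq> C"
  have free: "- dom (fun_of (thin X B p)) \<subseteq> blocks X B" if "hits X p" for B p
    using that by (auto simp: fun_of_thin)
  have "- dom (fun_of r) \<subseteq> blocks X B \<inter> blocks X C"
    using free[OF assms(1), of B] free[OF assms(2), of C] silver_le_dom[OF assms(3)] silver_le_dom[OF assms(4)]
    by blast
  moreover have "finite (blocks X B \<inter> blocks X C)"
    using assms(1) \<open>B \<noteq> C\<close> by (intro finite_blocks_Int) (simp_all add: hits_def)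
  ultimately show False using infinite_free finite_subset by blast
qed

section \<open>Counting conditions, and collapsing the continuum onto the family\<close>

lemma countable_powerset_le:
  assumes "inj (f :: 'a \<Rightarrow> nat)"
  shows "|UNIV :: 'a set set| \<le>o |UNIV :: nat set set|"
proof -
  have "inj ((`) f)" using assms by (simp add: inj_image_eq_iff inj_def)
  then show ?thesis by (simp add: card_of_ordLeqI)
qed

lemma card_silver_le: "|UNIV :: silver set| \<le>o |UNIV :: nat set set|"
proof -
  have "inj (\<lambda>p. Map.graph (fun_of p))"
    by (intro injI order_antisym silver_leI) (metis in_graphI in_graphD)+
  then have "|UNIV :: silver set| \<le>o |UNIV :: (nat \<times> bool) set set|"
    by (simp add: card_of_ordLeqI)
  moreover have "|UNIV :: (nat \<times> bool) set set| \<le>o |UNIV :: nat set set|"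
    by (rule countable_powerset_le[of to_nat]) (rule inj_to_nat)
  ultimately show ?thesis by (rule ordLeq_transitive)
qed

text \<open>\<open>H X q c\<close> expresses that \<open>q\<close> forces \<open>X\<close> to code
  \<open>c\<close>: a thinning along \<open>X\<close> with a branch assigned to \<open>c\<close>
  lies below \<open>q\<close>. The three properties say that \<open>H\<close> names a partial
  function on \<open>F\<close> which takes every value of type \<open>'c\<close> in the extension,
  the last one by density.\<close>

lemma collapse:
  fixes F :: "nat set set"
  assumes F: "weakly_dominating F" and code: "|UNIV :: 'c set| \<le>o |UNIV :: nat set set|"
  obtains H :: "nat set \<Rightarrow> silver \<Rightarrow> 'c \<Rightarrow> bool"
  where "\<And>X p q c. H X p c \<Longrightarrow> p \<le> q \<Longrightarrow> H X q c"
    and "\<And>X p c c'. H X p c \<Longrightarrow> H X p c' \<Longrightarrow> c = c'"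
    and "\<And>p c. \<exists>X\<in>F. \<exists>q\<ge>p. H X q c"
proof -
  have "|(UNIV :: silver set) \<times> (UNIV :: 'c set)| \<le>o |UNIV :: nat set set|"
    using card_silver_le code
    by (intro card_of_Sigma_ordLeq_infinite) (simp_all add: Finite_Set.finite_set)
  then obtain \<Phi> :: "silver \<times> 'c \<Rightarrow> nat set" where \<Phi>: "inj \<Phi>"
    by (auto simp flip: card_of_ordLeq)
  define H where "H X q c \<longleftrightarrow> (\<exists>p. hits X p \<and> thin X (\<Phi> (p, c)) p \<le> q)" for X q c
  show ?thesis
  proof (rule that[of H])
    fix X p q c assume "H X p c" "p \<le> q"
    then show "H X q c" unfolding H_def using order_trans by blast
  next
    fix X p c c' assume "H X p c" "H X p c'"
    then obtain q q' where "\<Phi> (q, c) = \<Phi> (q', c')" unfolding H_def using thin_compatible by blast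
    then show "c = c'" using \<Phi> by (auto dest: injD)
  next
    fix p c
    show "\<exists>X\<in>F. \<exists>q\<ge>p. H X q c"
      using weakly_dominating_hits[OF F, of p] thin_le unfolding H_def by blast
  qed
qed

text \<open>Diagonalisation against a finite family: the points of \<open>Y\<close> are spread so
  far apart that the first interval of any level, for any member, contains at most one of them.
  Infinity of \<open>F\<close> later gives the identification of \<open>F\<close> with omega times
  \<open>F\<close>.\<close>

lemma infinite_if_weakly_dominating:
  assumes "weakly_dominating F"
  shows "infinite F"
proof
  assume "finite F"
  have inf: "infinite X" if "X \<in> F" for X using assms that by (simp add: weakly_dominating_def)
  \<comment> \<open>The sum bounds all members of the finite family simultaneously. The index
    \<open>2 ^ Suc y\<close> is chosen because an interval that starts at or before \<open>y\<close>
    on level \<open>i\<close> satisfies \<open>i < y\<close>, so its right end has a smaller or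
    equal index.\<close>
  define G where "G y = Suc (y + (\<Sum>X\<in>F. enumerate X (2 ^ Suc y)))" for y
  have G: "enumerate X (2 ^ Suc y) < G y" if "X \<in> F" for X y
    using member_le_sum[of X F "\<lambda>X. enumerate X (2 ^ Suc y)"] that \<open>finite F\<close> by (simp add: G_def)
  define Y where "Y = range (\<lambda>n. (G ^^ n) 0)"
  have step: "(G ^^ n) 0 < (G ^^ Suc n) 0" for n by (simp add: G_def)
  have sm: "strict_mono (\<lambda>n. (G ^^ n) 0)" using step by (rule strict_mono_Suc_iff[THEN iffD2, rule_format])
  then have "infinite Y" by (simp add: Y_def range_inj_infinite strict_mono_imp_inj_on)
  then obtain X where X: "X \<in> F" and "\<exists>\<^sub>\<infinity>i. \<forall>j<2 ^ i.
      card ({enumerate X (2 ^ i + j)..<enumerate X (2 ^ i + j + 1)} \<inter> Y) \<ge> 2"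
    using assms unfolding weakly_dominating_def by blast
  then obtain i where "\<forall>j<2 ^ i.
      card ({enumerate X (2 ^ i + j)..<enumerate X (2 ^ i + j + 1)} \<inter> Y) \<ge> 2"
    unfolding INFM_nat by blast
  then have "card ({enumerate X (2 ^ i)..<enumerate X (2 ^ i + 1)} \<inter> Y) \<ge> 2"
    by (elim allE[of _ 0]) simp
  then have "\<not> card ({enumerate X (2 ^ i)..<enumerate X (2 ^ i + 1)} \<inter> Y) \<le> Suc 0"
    by simp
  then obtain a b where ab: "a \<noteq> b" "a \<in> {enumerate X (2 ^ i)..<enumerate X (2 ^ i + 1)} \<inter> Y"
    "b \<in> {enumerate X (2 ^ i)..<enumerate X (2 ^ i + 1)} \<inter> Y"
    by (subst (asm) card_le_Suc0_iff_eq) (simp, blast)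
  define y where "y = min a b"
  define z where "z = max a b"
  have yz: "y \<in> Y" "z \<in> Y" "y < z" "enumerate X (2 ^ i) \<le> y" "z < enumerate X (2 ^ i + 1)"
    using ab by (auto simp: y_def z_def min_def max_def simp del: enumerate_Suc)
  then obtain m n where mn: "y = (G ^^ m) 0" "z = (G ^^ n) 0" by (auto simp: Y_def)
  then have "m < n" using yz(3) strict_mono_less[OF sm] by auto
  then have "G y \<le> z" using mn strict_mono_less_eq[OF sm, of "Suc m" n] by simp
  \<comment> \<open>This bounds the level by the point \<open>y\<close>; the right end of the
    interval then lies below \<open>G y\<close>, hence not above \<open>z\<close>, although
    \<open>z\<close> was taken inside the interval.\<close>
  have "i < 2 ^ i" by (rule less_exp)
  also have "2 ^ i \<le> enumerate X (2 ^ i)" using inf[OF X] by (rule le_enumerate)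
  also have "\<dots> \<le> y" by fact
  finally have "Suc i \<le> Suc y" by simp
  have "(2 :: nat) ^ i + 1 \<le> 2 ^ Suc i" by simp
  also have "\<dots> \<le> 2 ^ Suc y" using \<open>Suc i \<le> Suc y\<close> by (rule power_increasing) simp
  finally have "enumerate X (2 ^ i + 1) \<le> enumerate X (2 ^ Suc y)"
    using enumerate_mono_le_iff[OF inf[OF X]] by blast
  then show False using G[OF X, of y] \<open>G y \<le> z\<close> yz(5) by simp
qed

subsection \<open>Names of reals\<close>

definition real_name :: "(nat \<times> silver) set \<Rightarrow> ('i, silver) name" where
  "real_name S = mk_name ((\<lambda>(n, p). (segment_name natLeq n, p)) ` S)"

text \<open>A ground model code for a real: \<open>(n, l)\<close> in \<open>C\<close> says that the
  finite information \<open>l\<close> about the generic real puts \<open>n\<close> into it.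
  Association lists represent finite partial functions by a countable type, so there are at most
  continuum many codes.\<close>

definition code_set :: "(nat \<times> (nat \<times> bool) list) set \<Rightarrow> (nat \<times> silver) set" where
  "code_set C = {(n, p). \<exists>l. (n, l) \<in> C \<and> map_of l \<subseteq>\<^sub>m fun_of p}"

lemma code_set_mono: "(n, p) \<in> code_set C \<Longrightarrow> p \<le> q \<Longrightarrow> (n, q) \<in> code_set C"
  unfolding code_set_def less_eq_silver_def using map_le_trans by blast

text \<open>The code attached to \<open>X\<close> varies with the generic filter. The name therefore
  collects, for each condition that settles a code, the numbers this code yields there; conditions
  that settle none contribute nothing.\<close>

definition collapsed_real :: "('x \<Rightarrow> silver \<Rightarrow> (nat \<times> (nat \<times> bool) list) set \<Rightarrow> bool) \<Rightarrow>
    'x \<Rightarrow> ('i, silver) name" where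
  "collapsed_real H X = real_name {(n, p). \<exists>C. H X p C \<and> (n, p) \<in> code_set C}"

definition ground_real :: "nat set \<Rightarrow> ('i, silver) name" where
  "ground_real A = real_name (A \<times> {bot})"

context
  assumes continuum_le: "|UNIV :: nat set set| \<le>o |UNIV :: 'i set|"
begin

lemma infinite_index_if_continuum_le: "infinite (UNIV :: 'i set)"
  using card_of_ordLeq_infinite[OF continuum_le] by (simp add: Finite_Set.finite_set)

lemma nat_le: "|UNIV :: nat set| \<le>o |UNIV :: nat set set|"
  unfolding infinite_iff_card_of_nat[symmetric] by (simp add: Finite_Set.finite_set)

lemma Field_natLeq_le: "|Field natLeq| \<le>o |UNIV :: 'i set|"
  unfolding Field_natLeq using nat_le continuum_le by (rule ordLeq_transitive)

lemma elems_real_name: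
  "elems (real_name S :: ('i, silver) name) = (\<lambda>(n, p). (segment_name natLeq n, p)) ` S"
  (is "_ = ?f ` S")
  unfolding real_name_def
proof (rule elems_mk_name)
  have "|?f ` S| \<le>o |S|" by (rule card_of_image)
  also have "|S| \<le>o |(UNIV :: nat set) \<times> (UNIV :: silver set)|" by (rule card_of_mono1) simp
  also have "|(UNIV :: nat set) \<times> (UNIV :: silver set)| \<le>o |UNIV :: nat set set|"
    using nat_le card_silver_le
    by (intro card_of_Sigma_ordLeq_infinite) (simp_all add: Finite_Set.finite_set)
  finally show "|?f ` S| \<le>o |UNIV :: 'i set|" using continuum_le by (rule ordLeq_transitive)
qed

lemma Mem_omegaE:
  assumes "(x \<^bold>\<in> ordinal_name natLeq) p"
  obtains n q where "p \<le> q" "forces_eq x (segment_name natLeq n :: ('i, silver) name) q"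
  using assms by (elim MemE) (auto simp: elems_ordinal_name[OF Field_natLeq_le])

lemma Mem_real_nameI:
  assumes "(n, s) \<in> S" "s \<le> p"
  shows "(segment_name natLeq n \<^bold>\<in> (real_name S :: ('i, silver) name)) p"
proof -
  have "(segment_name natLeq n, s) \<in> elems (real_name S :: ('i, silver) name)"
    using assms(1) by (force simp: elems_real_name)
  from Mem_elem[OF this, of p] show ?thesis using assms(2) by simp
qed

lemma Mem_real_nameE:
  assumes "(segment_name natLeq n \<^bold>\<in> (real_name S :: ('i, silver) name)) p"
  obtains s q where "(n, s) \<in> S" "p \<le> q" "s \<le> q"
proof -
  obtain w q where w: "w \<in> elems (real_name S :: ('i, silver) name)" "p \<le> q" "snd w \<le> q"
    "forces_eq (segment_name natLeq n) (fst w) q"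
    using assms by (rule MemE)
  then obtain m where m: "(m, snd w) \<in> S" "fst w = segment_name natLeq m"
    by (auto simp: elems_real_name)
  have "n = m"
    using segment_name_eq_imp_eq[OF natLeq_Well_order Field_natLeq_le, of n m q] w(4) m(2)
    by (simp add: Field_natLeq)
  then show ?thesis using that m w by blast
qed

lemma real_name_subset_omega: "is_subset (real_name S :: ('i, silver) name) (ordinal_name natLeq) p"
proof (rule is_subsetI)
  fix z q assume "z \<in> elems (real_name S :: ('i, silver) name)"
  then obtain n where n: "fst z = segment_name natLeq n" by (auto simp: elems_real_name)
  have "(segment_name natLeq n, bot) \<in> elems (ordinal_name natLeq :: ('i, silver) name)"
    by (auto simp: elems_ordinal_name[OF Field_natLeq_le] Field_natLeq)
  from Mem_elem[OF this, of q] show "(fst z \<^bold>\<in> ordinal_name natLeq) q" by (simp add: n)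
qed

text \<open>Every element of a subset of omega is, densely, a specific ground model natural number,
  so it is enough to test those.\<close>

lemma subset_if_Mem_segment_name:
  fixes x y :: "('i, silver) name"
  assumes x: "is_subset x (ordinal_name natLeq) p"
    and xy: "\<And>n q. p \<le> q \<Longrightarrow> (segment_name natLeq n \<^bold>\<in> x) q \<Longrightarrow> (segment_name natLeq n \<^bold>\<in> y) q"
  shows "is_subset x y p"
  unfolding is_subset_iff
proof (intro allI impI)
  fix z q assume q: "p \<le> q" "(z \<^bold>\<in> x) q"
  show "(z \<^bold>\<in> y) q"
  proof (rule Mem_dense)
    fix s assume "q \<le> s"
    then have "(z \<^bold>\<in> x) s" "p \<le> s" using q Mem_mono order_trans by blast+
    then have "(z \<^bold>\<in> ordinal_name natLeq) s" using x by (auto simp: is_subset_iff)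
    then obtain n t where t: "s \<le> t" "forces_eq z (segment_name natLeq n) t"
      by (rule Mem_omegaE)
    have "(segment_name natLeq n \<^bold>\<in> x) t"
      using Mem_cong_left[OF t(2)] Mem_mono[OF \<open>(z \<^bold>\<in> x) s\<close> t(1)] by blast
    then have "(segment_name natLeq n \<^bold>\<in> y) t" using xy \<open>p \<le> s\<close> t(1) order_trans by blast
    then show "\<exists>t\<ge>s. (z \<^bold>\<in> y) t" using t Mem_cong_left forces_eq_sym by blast
  qed
qed

lemma reals_eqI:
  fixes x y :: "('i, silver) name"
  assumes "is_subset x (ordinal_name natLeq) p" "is_subset y (ordinal_name natLeq) p"
    and "\<And>n q. p \<le> q \<Longrightarrow> (segment_name natLeq n \<^bold>\<in> x) q \<longleftrightarrow> (segment_name natLeq n \<^bold>\<in> y) q"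
  shows "forces_eq x y p"
proof (rule forces_eq_if_is_subset)
  show "is_subset x y p"
    using assms(1) by (rule subset_if_Mem_segment_name) (use assms(3) in blast)
  show "is_subset y x p"
    using assms(2) by (rule subset_if_Mem_segment_name) (use assms(3) in blast)
qed

text \<open>Below a fusion for the sentences \<open>n \<in> x\<close>, each of them is decided by finitely many
  further values of the generic real.\<close>

lemma continuous_reading:
  fixes x :: "('i, silver) name"
  assumes x: "is_subset x (ordinal_name natLeq) p"
  shows "\<exists>q\<ge>p. \<exists>C. forces_eq x (real_name (code_set C)) q"
proof -
  define M where "M n q \<longleftrightarrow> (segment_name natLeq n \<^bold>\<in> x) q" for n q
  have M_mono: "M n q \<Longrightarrow> q \<le> r \<Longrightarrow> M n r" for n q r unfolding M_def by (rule Mem_mono)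
  \<comment> \<open>\<open>D n\<close> holds where membership of \<open>n\<close> is settled; the
    fusion reduces settling it to a finite set of values.\<close>
  define D where "D n q \<longleftrightarrow> M n q \<or> (\<forall>r\<ge>q. \<not> M n r)" for n q
  have "\<exists>q\<ge>p. \<forall>r\<ge>q. D n r" for n p
  proof (cases "\<exists>q\<ge>p. M n q")
    case True
    then show ?thesis unfolding D_def using M_mono by blast
  next
    case False
    then show ?thesis unfolding D_def using order_trans by blast
  qed
  then obtain q where q: "p \<le> q" "\<And>n. \<exists>a. finite a \<and> (\<forall>r\<ge>q. a \<subseteq> dom (fun_of r) \<longrightarrow> D n r)"
    by (rule fusion[where D = D and p = p]) blast
  define C where "C = {(n, l). \<forall>r\<ge>q. map_of l \<subseteq>\<^sub>m fun_of r \<longrightarrow> M n r}"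
  have C: "\<exists>s\<ge>r. (n, s) \<in> code_set C" if r: "q \<le> r" "M n r" for n r
  proof -
    obtain a where a: "finite a" "\<forall>r\<ge>q. a \<subseteq> dom (fun_of r) \<longrightarrow> D n r" using q(2)[of n] by blast
    obtain s where s: "r \<le> s" "a \<subseteq> dom (fun_of s)" using extension_domain[OF a(1)] by blast
    define l where "l = map (\<lambda>x. (x, the (fun_of s x))) (sorted_list_of_set a)"
    have l: "map_of l = (\<lambda>x. if x \<in> a then fun_of s x else None)"
      using a(1) s(2) by (auto simp: l_def map_of_map_restrict restrict_map_def fun_eq_iff)
    have "M n t" if t: "q \<le> t" "map_of l \<subseteq>\<^sub>m fun_of t" for t
    proof -
      \<comment> \<open>\<open>f\<close> adds to \<open>q\<close> just the information in
        \<open>l\<close>. It is total on \<open>a\<close>, so it settles whether \<open>n\<close> is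
        in \<open>x\<close>; since it lies below \<open>s\<close>, which forces membership, it
        settles it positively, and so does \<open>t\<close> above it.\<close>
      define f where "f = fun_of q ++ map_of l"
      have ft: "f \<subseteq>\<^sub>m fun_of t"
        unfolding f_def using t by (intro map_add_le_mapI) (auto simp: less_eq_silver_def)
      then have "- dom (fun_of t) \<subseteq> - dom f" using map_le_implies_dom_le by blast
      then have "infinite (- dom f)" by (rule infinite_super) (rule infinite_free)
      then have f: "fun_of (Silver f) = f" by (rule fun_of_Silver)
      have "q \<le> s" using r(1) s(1) by (rule order_trans)
      then have "f \<subseteq>\<^sub>m fun_of s"
        unfolding f_def by (intro map_add_le_mapI) (auto simp: less_eq_silver_def l map_le_def)
      then have us: "Silver f \<le> s" "Silver f \<le> t"
        using ft by (simp_all add: less_eq_silver_def f)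
      have "q \<le> Silver f"
      proof (rule silver_leI)
        fix y b assume "fun_of q y = Some b"
        then show "fun_of (Silver f) y = Some b"
          using silver_le_app[OF \<open>q \<le> s\<close>] unfolding f
          by (auto simp: f_def l map_add_def split: option.split)
      qed
      moreover have "a \<subseteq> dom (fun_of (Silver f))"
        using s(2) unfolding f by (auto simp: f_def l)
      ultimately have "D n (Silver f)" using a(2) by blast
      moreover have "M n s" using M_mono[OF r(2) s(1)] .
      ultimately have "M n (Silver f)" using us(1) unfolding D_def by blast
      then show ?thesis using us(2) by (rule M_mono)
    qed
    then have "(n, l) \<in> C" by (simp add: C_def)
    moreover have "map_of l \<subseteq>\<^sub>m fun_of s" by (auto simp: l map_le_def)
    ultimately show ?thesis using s(1) by (auto simp: code_set_def)
  qed
  let ?R = "real_name (code_set C) :: ('i, silver) name"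
  have "forces_eq x ?R q"
  proof (rule reals_eqI)
    fix n r assume r: "q \<le> r"
    show "(segment_name natLeq n \<^bold>\<in> x) r \<longleftrightarrow> (segment_name natLeq n \<^bold>\<in> ?R) r"
    proof
      assume M: "(segment_name natLeq n \<^bold>\<in> x) r"
      show "(segment_name natLeq n \<^bold>\<in> ?R) r"
      proof (rule Mem_dense)
        fix s assume "r \<le> s"
        then have "M n s" "q \<le> s" unfolding M_def using Mem_mono[OF M] r order_trans by blast+
        then obtain t where t: "s \<le> t" "(n, t) \<in> code_set C" using C by blast
        have "(segment_name natLeq n \<^bold>\<in> ?R) t"
          using t(2) order_refl by (rule Mem_real_nameI)
        with t(1) show "\<exists>t\<ge>s. (segment_name natLeq n \<^bold>\<in> ?R) t"
          by blast
      qed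
    next
      assume M: "(segment_name natLeq n \<^bold>\<in> ?R) r"
      show "(segment_name natLeq n \<^bold>\<in> x) r"
      proof (rule Mem_dense)
        fix s assume s: "r \<le> s"
        obtain u t where t: "(n, u) \<in> code_set C" "s \<le> t" "u \<le> t"
          using Mem_mono[OF M s] by (rule Mem_real_nameE)
        have "q \<le> t" using r s t(2) order_trans by blast
        then have "M n t" using code_set_mono[OF t(1,3)] by (auto simp: code_set_def C_def)
        then show "\<exists>t\<ge>s. (segment_name natLeq n \<^bold>\<in> x) t" using t(2) unfolding M_def by blast
      qed
    qed
  qed (use is_subset_mono[OF x q(1)] real_name_subset_omega in auto)
  then show ?thesis using q(1) by blast
qed

text \<open>By uniqueness, only the code \<open>C\<close> can occur from \<open>p\<close> upwards.
  Membership of a number in a real name with an upward closed set of conditions means density of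
  that set, and density above \<open>p\<close> sees nothing else.\<close>

lemma collapsed_real_eq:
  assumes mono: "\<And>p q C. H X p C \<Longrightarrow> p \<le> q \<Longrightarrow> H X q C"
    and unique: "\<And>p C C'. H X p C \<Longrightarrow> H X p C' \<Longrightarrow> C = C'"
    and p: "H X p C"
  shows "forces_eq (collapsed_real H X) (real_name (code_set C) :: ('i, silver) name) p"
  unfolding collapsed_real_def
proof (intro reals_eqI real_name_subset_omega)
  fix n q assume q: "p \<le> q"
  let ?S = "{(n, p). \<exists>C. H X p C \<and> (n, p) \<in> code_set C}"
  have eq: "(n, r) \<in> ?S \<longleftrightarrow> (n, r) \<in> code_set C" if "p \<le> r" for r
    using mono[OF p that] unique by blast
  have S_mono: "(n, r) \<in> ?S \<Longrightarrow> r \<le> s \<Longrightarrow> (n, s) \<in> ?S" for r s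
    using mono code_set_mono by blast
  have iff: "(segment_name natLeq n \<^bold>\<in> (real_name T :: ('i, silver) name)) q \<longleftrightarrow>
      (\<forall>r\<ge>q. \<exists>s\<ge>r. (n, s) \<in> T)" if T: "\<And>r s. (n, r) \<in> T \<Longrightarrow> r \<le> s \<Longrightarrow> (n, s) \<in> T" for T
  proof
    assume M: "(segment_name natLeq n \<^bold>\<in> (real_name T :: ('i, silver) name)) q"
    show "\<forall>r\<ge>q. \<exists>s\<ge>r. (n, s) \<in> T"
    proof (intro allI impI)
      fix r assume "q \<le> r"
      obtain u s where "(n, u) \<in> T" "r \<le> s" "u \<le> s"
        using Mem_mono[OF M \<open>q \<le> r\<close>] by (rule Mem_real_nameE)
      then show "\<exists>s\<ge>r. (n, s) \<in> T" using T by blast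
    qed
  next
    assume dense: "\<forall>r\<ge>q. \<exists>s\<ge>r. (n, s) \<in> T"
    show "(segment_name natLeq n \<^bold>\<in> (real_name T :: ('i, silver) name)) q"
    proof (rule Mem_dense)
      fix r assume "q \<le> r"
      then obtain s where s: "r \<le> s" "(n, s) \<in> T" using dense by blast
      have "(segment_name natLeq n \<^bold>\<in> (real_name T :: ('i, silver) name)) s"
        using s(2) order_refl by (rule Mem_real_nameI)
      with s(1) show "\<exists>s\<ge>r. (segment_name natLeq n \<^bold>\<in> (real_name T :: ('i, silver) name)) s"
        by blast
    qed
  qed
  have "(segment_name natLeq n \<^bold>\<in> (real_name ?S :: ('i, silver) name)) q \<longleftrightarrow>
      (\<forall>r\<ge>q. \<exists>s\<ge>r. (n, s) \<in> ?S)"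
    by (rule iff) (rule S_mono)
  also have "\<dots> \<longleftrightarrow> (\<forall>r\<ge>q. \<exists>s\<ge>r. (n, s) \<in> code_set C)"
    using eq order_trans[OF order_trans[OF q]] by meson
  also have "\<dots> \<longleftrightarrow> (segment_name natLeq n \<^bold>\<in> (real_name (code_set C) :: ('i, silver) name)) q"
    by (rule iff[symmetric]) (rule code_set_mono)
  finally show "(segment_name natLeq n \<^bold>\<in> (real_name ?S :: ('i, silver) name)) q \<longleftrightarrow>
      (segment_name natLeq n \<^bold>\<in> (real_name (code_set C) :: ('i, silver) name)) q" .
qed

lemma ground_real_inj:
  assumes "forces_eq (ground_real A) (ground_real B :: ('i, silver) name) p"
  shows "A = B"
proof -
  have "A \<subseteq> B" if eq: "forces_eq (ground_real A) (ground_real B :: ('i, silver) name) p" for A B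
  proof
    fix n assume "n \<in> A"
    then have "(segment_name natLeq n \<^bold>\<in> (ground_real A :: ('i, silver) name)) p"
      unfolding ground_real_def by (intro Mem_real_nameI[of n bot]) auto
    then have "(segment_name natLeq n \<^bold>\<in> (ground_real B :: ('i, silver) name)) p" using Mem_cong_right[OF eq] by blast
    then show "n \<in> B" unfolding ground_real_def by (elim Mem_real_nameE) auto
  qed
  then show ?thesis using assms forces_eq_sym by blast
qed

lemma continuum_is_card_of_weakly_dominating:
  assumes F: "weakly_dominating F"
  shows "continuum_is_card_of (ordinal_name |F| :: ('i, silver) name) p"
proof -
  have "infinite F" using F by (rule infinite_if_weakly_dominating)
  then have "|(UNIV :: nat set) \<times> F| =o |F|"
    using card_of_Times_infinite[of F "UNIV :: nat set"] by (simp add: infinite_iff_card_of_nat)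
  then have "|F| =o |(UNIV :: nat set) \<times> F|" by (rule ordIso_symmetric)
  then obtain d :: "nat set \<Rightarrow> nat \<times> nat set" where d: "bij_betw d F (UNIV \<times> F)"
    by (auto simp flip: card_of_ordIso)
  have code: "|UNIV :: (nat \<times> (nat \<times> bool) list) set set| \<le>o |UNIV :: nat set set|"
    by (rule countable_powerset_le[of to_nat]) (rule inj_to_nat)
  obtain H :: "nat set \<Rightarrow> silver \<Rightarrow> (nat \<times> (nat \<times> bool) list) set \<Rightarrow> bool"
    where H: "\<And>X p q C. H X p C \<Longrightarrow> p \<le> q \<Longrightarrow> H X q C"
      "\<And>X p C C'. H X p C \<Longrightarrow> H X p C' \<Longrightarrow> C = C'"
      "\<And>p C. \<exists>X\<in>F. \<exists>q\<ge>p. H X q C"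
    using collapse[OF F code, of thesis] by blast
  \<comment> \<open>Members of \<open>F\<close> are themselves sets of naturals, so they serve as
    the positive entries: \<open>inv_into F d\<close> assigns a different member to each pair
    \<open>(m, X)\<close>.\<close>
  define \<rho> :: "nat \<times> nat set \<Rightarrow> ('i, silver) name" where
    "\<rho> = (\<lambda>(n, X). case n of 0 \<Rightarrow> collapsed_real H X | Suc m \<Rightarrow> ground_real (inv_into F d (m, X)))"
  interpret exhaustive_names "|F|" d \<rho>
  proof unfold_locales
    show "infinite (UNIV :: 'i set)" by (rule infinite_index_if_continuum_le)
    show "Well_order |F|" by (rule card_of_Well_order)
    have "|F \<times> (UNIV :: silver set)| \<le>o |UNIV :: nat set set|"
      using card_silver_le card_of_mono1[OF subset_UNIV, of F]
      by (intro card_of_Sigma_ordLeq_infinite) (simp_all add: Finite_Set.finite_set)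
    then show "|Field |F| \<times> (UNIV :: silver set)| \<le>o |UNIV :: 'i set|"
      unfolding Field_card_of using continuum_le by (rule ordLeq_transitive)
    show "bij_betw d (Field |F| ) (UNIV \<times> Field |F| )" unfolding Field_card_of by (rule d)
  next
    fix k n p
    show "is_subset (\<rho> (n, k)) (ordinal_name natLeq) p"
      by (cases n) (simp_all add: \<rho>_def collapsed_real_def ground_real_def real_name_subset_omega)
  next
    fix x p assume "is_subset x (ordinal_name natLeq :: ('i, silver) name) p"
    then obtain q C where q: "p \<le> q" "forces_eq x (real_name (code_set C)) q"
      using continuous_reading by blast
    obtain X s where s: "X \<in> F" "q \<le> s" "H X s C" using H(3) by blast
    have "forces_eq (collapsed_real H X) (real_name (code_set C) :: ('i, silver) name) s"
      by (rule collapsed_real_eq; fact H s(3))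
    then have "forces_eq x (collapsed_real H X) s"
      using forces_eq_trans[OF forces_eq_mono[OF q(2) s(2)]] forces_eq_sym by blast
    then show "\<exists>q\<ge>p. \<exists>k\<in>Field |F|. forces_eq x (\<rho> (0, k)) q"
      unfolding Field_card_of using q(1) s order_trans by (auto simp: \<rho>_def)
  next
    fix m k n l p
    assume "forces_eq (\<rho> (Suc m, k)) (\<rho> (Suc n, l)) p" and kl: "k \<in> Field |F|" "l \<in> Field |F|"
    then have "inv_into F d (m, k) = inv_into F d (n, l)"
      using ground_real_inj by (simp add: \<rho>_def)
    then show "(m, k) = (n, l)"
      using d kl by (simp only: Field_card_of) (metis SigmaI UNIV_I bij_betw_imp_surj_on inv_into_injective)
  qed
  show ?thesis by (rule continuum_is_card_of_ordinal_name)
qed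

end

theorem theorem4p1:
  assumes "|UNIV :: nat set set| \<le>o |UNIV :: 'i set|"
  shows "\<^bold>\<turnstile> continuum_is_card_of (ordinal_name b_plus_eps :: ('i, silver) name)"
  \<comment> \<open>\<open>b_plus_eps\<close> is equal, not merely isomorphic, to \<open>|F|\<close>
    for a weakly dominating \<open>F\<close>, so rewriting transfers the statement about
    names.\<close>
  using b_plus_eps_minimal continuum_is_card_of_weakly_dominating[OF assms]
  unfolding forced_def by metis

end
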